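(* Over a field of characteristic $0$, let $k,m\ge 1$ be integers and let $Z\subset\mathbb{P}^2$ be the generic union of $k^2$ fat points of multiplicity $m$. Then $H(Z)=H_v(Z)$, i.e. for every $d\in\mathbb{N}$, $$H(Z,d)=\min\left(\frac{(d+1)(d+2)}{2},\ k^2\,\frac{m(m+1)}{2}\right).$$
   Context: A fat point of multiplicity $m$ in $\mathbb{P}^2$ is the subscheme defined by the $m$-th power of the ideal of a point. The generic union of fat points is the union supported at generic points of $\mathbb{P}^2$ (the subscheme parametrized by the generic point of the parameter space of such unions). For a $0$-dimensional subscheme $Z\subset\mathbb{P}^2$, $H(Z,d)$ is its Hilbert function, i.e. $\frac{(d+1)(d+2)}{2}$ minus the dimension of the space of sections of $\mathcal{O}_{\mathbb{P}^2}(d)$ vanishing on $Z$. The virtual Hilbert function of $Z$ is $H_v(Z,d)=\min\left(\frac{(d+1)(d+2)}{2},\deg Z\right)$. *)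

theory Defs
  imports Complex_Main "HOL-Library.Poly_Mapping" "HOL-Library.Numeral_Type"
begin

text \<open>
  A multivariate polynomial is a finitely supported map from exponent vectors to coefficients.
  For the homogeneous coordinate ring of the projective plane the variables are indexed by the
  type \<^typ>\<open>3\<close>, whose three elements are 0, 1 and 2 (with 3 = 0).
\<close>

type_synonym ('v, 'a) mpoly = "('v \<Rightarrow>\<^sub>0 nat) \<Rightarrow>\<^sub>0 'a"

definition mpoly_eval :: "('v \<Rightarrow> 'a) \<Rightarrow> ('v, 'a::comm_ring_1) mpoly \<Rightarrow> 'a" where
  "mpoly_eval c f =
     (\<Sum>e \<in> Poly_Mapping.keys f.
        Poly_Mapping.lookup f e * (\<Prod>v \<in> Poly_Mapping.keys e. c v ^ Poly_Mapping.lookup e v))"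

definition mpoly_scale :: "'a::comm_ring_1 \<Rightarrow> ('v, 'a) mpoly \<Rightarrow> ('v, 'a) mpoly" where
  "mpoly_scale a f = Poly_Mapping.single 0 a * f"

lemma vector_space_mpoly_scale:
  "vector_space (mpoly_scale :: 'a::field \<Rightarrow> ('v, 'a) mpoly \<Rightarrow> ('v, 'a) mpoly)"
  by unfold_locales
    (simp_all add: mpoly_scale_def algebra_simps single_add mult_single flip: mult.assoc)

text \<open>The zero polynomial is homogeneous of every degree.\<close>

definition homogeneous :: "nat \<Rightarrow> (3, 'a::comm_ring_1) mpoly \<Rightarrow> bool" where
  "homogeneous d f \<longleftrightarrow>
     (\<forall>e \<in> Poly_Mapping.keys f. (\<Sum>v \<in> UNIV. Poly_Mapping.lookup e v) = d)"

definition ideal_generated :: "'r::comm_ring_1 set \<Rightarrow> 'r set" where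
  "ideal_generated S = module.span (*) S"

lemma module_times: "module ((*) :: 'r::comm_ring_1 \<Rightarrow> 'r \<Rightarrow> 'r)"
  by unfold_locales (simp_all add: algebra_simps)

primrec ideal_power :: "'r::comm_ring_1 set \<Rightarrow> nat \<Rightarrow> 'r set" where
  "ideal_power I 0 = UNIV"
| "ideal_power I (Suc n) = ideal_generated {a * b | a b. a \<in> I \<and> b \<in> ideal_power I n}"

definition point_ideal :: "(3 \<Rightarrow> 'a::field) \<Rightarrow> (3, 'a) mpoly set" where
  "point_ideal p = ideal_generated {f. (\<exists>d. homogeneous d f) \<and> mpoly_eval p f = 0}"

text \<open>
  Homogeneous ideal of the union of the fat points of multiplicity \<open>m\<close> supported at
  \<open>P 0, \<dots>, P (r - 1)\<close>, which are given by homogeneous coordinates.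
\<close>

definition fat_points_ideal :: "nat \<Rightarrow> nat \<Rightarrow> (nat \<Rightarrow> 3 \<Rightarrow> 'a::field) \<Rightarrow> (3, 'a) mpoly set" where
  "fat_points_ideal r m P = (\<Inter>i<r. ideal_power (point_ideal (P i)) m)"

text \<open>
  Forms of degree \<open>d\<close> vanishing on the closed subscheme of the projective plane cut out by a
  homogeneous ideal \<open>J\<close>, that is, global sections of the \<open>d\<close>-th twist of the ideal sheaf
  associated with \<open>J\<close>. These are the degree \<open>d\<close> elements of the saturation of \<open>J\<close>.
\<close>

definition sections_vanishing :: "(3, 'a::field) mpoly set \<Rightarrow> nat \<Rightarrow> (3, 'a) mpoly set" where
  "sections_vanishing J d =
     {f. homogeneous d f \<and> (\<exists>n. \<forall>g. homogeneous n g \<longrightarrow> g * f \<in> J)}"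

definition hilbert_function :: "(3, 'a::field) mpoly set \<Rightarrow> nat \<Rightarrow> int" where
  "hilbert_function J d =
     int ((d + 1) * (d + 2) div 2) - int (vector_space.dim mpoly_scale (sections_vanishing J d))"

definition is_subfield :: "'a::field set \<Rightarrow> bool" where
  "is_subfield F \<longleftrightarrow> 1 \<in> F \<and> (\<forall>x\<in>F. \<forall>y\<in>F. x - y \<in> F \<and> x * y \<in> F) \<and> (\<forall>x\<in>F. inverse x \<in> F)"

definition algebraically_independent ::
  "'a::field set \<Rightarrow> 'i set \<Rightarrow> ('i \<Rightarrow> 'a) \<Rightarrow> bool" where
  "algebraically_independent F I c \<longleftrightarrow>
     (\<forall>f :: ('i, 'a) mpoly.
        (\<forall>e. Poly_Mapping.lookup f e \<in> F) \<longrightarrow>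
        (\<forall>e \<in> Poly_Mapping.keys f. Poly_Mapping.keys e \<subseteq> I) \<longrightarrow>
        mpoly_eval c f = 0 \<longrightarrow> f = 0)"

text \<open>
  The points \<open>P 0, \<dots>, P (r - 1)\<close>, with coordinates in an extension field \<open>'a\<close> of \<open>F\<close>, lie over
  the generic point of the \<open>r\<close>-fold product of the projective plane over \<open>F\<close>: all of them are in
  the standard chart where coordinate 0 is nonzero, and their \<open>2 r\<close> affine coordinates are
  algebraically independent over \<open>F\<close>. The residue field of that generic point is generated by
  these coordinates over \<open>F\<close>; \<open>'a\<close> may be that field or any larger one.
\<close>

definition generic_points :: "'a::field set \<Rightarrow> nat \<Rightarrow> (nat \<Rightarrow> 3 \<Rightarrow> 'a) \<Rightarrow> bool" where
  "generic_points F r P \<longleftrightarrow>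
     (\<forall>i<r. P i 0 \<noteq> 0) \<and>
     algebraically_independent F ({..<r} \<times> {1, 2}) (\<lambda>(i, j). P i j / P i 0)"

end

theory Submission
  imports Defs "HOL-Computational_Algebra.Polynomial"
begin

text \<open>
  In affine coordinates, the forms of degree \<open>d\<close> are the polynomials supported on a triangle of
  exponents \<open>(a, b)\<close>. In characteristic 0, the conditions imposed by a point of multiplicity \<open>m\<close> in
  the torus are the values on the exponents of all polynomials of degree less than \<open>m\<close>, twisted by the
  monomials. Let a set \<open>D\<close> of exponents be nondegenerate for \<open>s\<close> points if no nonzero polynomial
  supported on \<open>D\<close> satisfies the conditions at some \<open>s\<close> points of the torus. Letting one point tend
  to the boundary of the torus, one sees that \<open>D\<close> is nondegenerate for \<open>s + 1\<close> points if a set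
  \<open>B\<close> that is unisolvent for polynomials of degree less than \<open>m\<close> can be split off greedily (for instance by
  a line) so that the rest is nondegenerate for \<open>s\<close> points. Since nondegeneracy is open, it passes to
  generic points.

  It remains to decompose. Take the triangle with sides as large as possible and at most
  \<open>k\<^sup>2 m (m + 1) / 2\<close> exponents, and complete it to exactly this number by part of one further column.
  From this set a vertical strip, about \<open>m + 1/2\<close> columns wide, is split off. It is exactly
  decomposed into \<open>2 k - 1\<close> unisolvent sets whose columns have \<open>1, \<dots>, m\<close> points in some order, like
  the triangles of both orientations in such a strip, and what is left is the set of the same
  kind for \<open>k - 1\<close>.
\<close>

subsection \<open>Linear systems with trivial kernel\<close>

text \<open>One exponent set, independent of the degree, settles all degrees. It has as many
  exponents as there are conditions: a degree whose triangle fits into it after a shift by one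
  column admits no form, and in every other degree the set lies inside the triangle and each further
  exponent contributes exactly one form. Jets and ideals are therefore compared in one direction
  only; the other estimate is a dimension count.

  The width \<open>m + 1/2\<close> comes from completing the square:
  \<open>n (n + 1) + 2 p = k^2 m (m + 1)\<close> means
  \<open>(2 n + 1)^2 + 8 p = k^2 (2 m + 1)^2 - k^2 + 1\<close>, so the side \<open>n\<close> is
  roughly \<open>k (m + 1/2)\<close>. The number \<open>2 k - 1\<close> is
  \<open>k^2 - (k - 1)^2\<close>. The obstacle is rounding: widths are integers, and every removed
  set needs exactly \<open>m (m + 1) / 2\<close> points. Hence the incomplete columns on the sides
  of a strip. One of their lengths is divided with remainder by \<open>m + 1\<close> or
  \<open>m\<close>, and the middle part of the strip absorbs the remainder.\<close>

definition kernel_trivial :: "('i \<Rightarrow> 'e \<Rightarrow> 'a::comm_ring_1) \<Rightarrow> 'i set \<Rightarrow> 'e set \<Rightarrow> bool" where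
  "kernel_trivial c I D \<longleftrightarrow>
     (\<forall>f. (\<forall>i\<in>I. (\<Sum>e\<in>D. c i e * f e) = 0) \<longrightarrow> (\<forall>e\<in>D. f e = 0))"

definition is_ring_hom :: "('r::comm_ring_1 \<Rightarrow> 'a::comm_ring_1) \<Rightarrow> bool" where
  "is_ring_hom \<phi> \<longleftrightarrow>
     \<phi> 1 = 1 \<and> (\<forall>x y. \<phi> (x - y) = \<phi> x - \<phi> y) \<and> (\<forall>x y. \<phi> (x * y) = \<phi> x * \<phi> y)"

text \<open>Elimination without division makes sense over a polynomial ring and commutes with ring
  homomorphisms.\<close>

definition eliminate :: "('i \<Rightarrow> 'e \<Rightarrow> 'r::comm_ring_1) \<Rightarrow> 'i \<Rightarrow> 'e \<Rightarrow> 'i \<Rightarrow> 'e \<Rightarrow> 'r" where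
  "eliminate l i e j e' = l i e * l j e' - l j e * l i e'"

text \<open>Row \<open>i\<close> determines the value at \<open>e\<close> from the values on
  \<open>D\<close>. Substituting it into row \<open>j\<close> and clearing the denominator
  \<open>l i e\<close> gives row \<open>j\<close> of the eliminated system.\<close>

lemma kernel_trivial_eliminate:
  fixes l :: "'i \<Rightarrow> 'e \<Rightarrow> 'a::field"
  assumes "finite D" "e \<notin> D" "i \<in> I" "l i e \<noteq> 0"
  shows "kernel_trivial l I (insert e D) \<longleftrightarrow> kernel_trivial (eliminate l i e) I D"
proof
  assume ker: "kernel_trivial l I (insert e D)"
  show "kernel_trivial (eliminate l i e) I D"
    unfolding kernel_trivial_def
  proof (intro allI impI)
    fix g assume g: "\<forall>j\<in>I. (\<Sum>e'\<in>D. eliminate l i e j e' * g e') = 0"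
    define f where "f = g(e := - (\<Sum>e'\<in>D. l i e' * g e') / l i e)"
    have fg: "(\<Sum>e'\<in>D. l j e' * f e') = (\<Sum>e'\<in>D. l j e' * g e')" for j
      using assms(2) by (intro sum.cong) (auto simp: f_def)
    have "(\<Sum>e'\<in>insert e D. l j e' * f e') = 0" if "j \<in> I" for j
    proof -
      have "l i e * (\<Sum>e'\<in>insert e D. l j e' * f e') =
          (\<Sum>e'\<in>D. eliminate l i e j e' * g e')"
      proof -
        have "(\<Sum>e'\<in>insert e D. l j e' * f e') = l j e * f e + (\<Sum>e'\<in>D. l j e' * g e')"
          using assms(1,2) fg[of j] by simp
        moreover have "l i e * f e = - (\<Sum>e'\<in>D. l i e' * g e')"
          using assms(4) by (simp add: f_def)
        moreover have "l i e * (l j e * f e) = l j e * (l i e * f e)" by simp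
        ultimately have "l i e * (\<Sum>e'\<in>insert e D. l j e' * f e') =
            l i e * (\<Sum>e'\<in>D. l j e' * g e') - l j e * (\<Sum>e'\<in>D. l i e' * g e')"
          by (simp add: distrib_left)
        then show ?thesis
          by (simp add: eliminate_def sum_subtractf sum_distrib_left algebra_simps)
      qed
      then show ?thesis using g that assms(4) by auto
    qed
    then have "\<forall>e'\<in>insert e D. f e' = 0"
      using ker unfolding kernel_trivial_def by blast
    then show "\<forall>e'\<in>D. g e' = 0" using assms(2) by (metis f_def fun_upd_other insertI2)
  qed
next
  assume ker: "kernel_trivial (eliminate l i e) I D"
  show "kernel_trivial l I (insert e D)"
    unfolding kernel_trivial_def
  proof (intro allI impI)
    fix f assume f: "\<forall>j\<in>I. (\<Sum>e'\<in>insert e D. l j e' * f e') = 0"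
    have sumD: "(\<Sum>e'\<in>D. l j e' * f e') = - (l j e * f e)" if "j \<in> I" for j
      using f that assms(1,2) by (simp add: add_eq_0_iff)
    have "(\<Sum>e'\<in>D. eliminate l i e j e' * f e') = 0" if "j \<in> I" for j
    proof -
      have "(\<Sum>e'\<in>D. eliminate l i e j e' * f e') =
          l i e * (\<Sum>e'\<in>D. l j e' * f e') - l j e * (\<Sum>e'\<in>D. l i e' * f e')"
        by (simp add: eliminate_def sum_subtractf sum_distrib_left algebra_simps)
      then show ?thesis using sumD[OF that] sumD[OF assms(3)] by (simp add: algebra_simps)
    qed
    then have z: "\<forall>e'\<in>D. f e' = 0"
      using ker unfolding kernel_trivial_def by blast
    then have "l i e * f e = 0" using sumD[OF assms(3)] by simp
    then show "\<forall>e'\<in>insert e D. f e' = 0" using z assms(4) by simp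
  qed
qed

lemma kernel_trivial_pivot:
  fixes c :: "'i \<Rightarrow> 'e \<Rightarrow> 'a::comm_ring_1"
  assumes "finite D" "kernel_trivial c I D" "e \<in> D"
  shows "\<exists>i\<in>I. c i e \<noteq> 0"
proof (rule ccontr)
  assume none: "\<not> ?thesis"
  have "(\<Sum>e'\<in>D. c i e' * (if e' = e then 1 else 0)) = 0" if "i \<in> I" for i
    using none that assms(1) by (auto intro: sum.neutral)
  then have "\<forall>e'\<in>D. (if e' = e then 1 else 0) = (0::'a)"
    using spec[OF assms(2)[unfolded kernel_trivial_def], of "\<lambda>e'. if e' = e then 1 else 0"]
    by blast
  from bspec[OF this assms(3)] show False by simp
qed

lemma kernel_trivial_card_le:
  fixes c :: "'i \<Rightarrow> 'e \<Rightarrow> 'a::field"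
  assumes "finite D" "finite I" "kernel_trivial c I D"
  shows "card D \<le> card I"
  using assms
proof (induction D arbitrary: c I rule: finite_induct)
  case (insert e D)
  have "\<exists>i\<in>I. c i e \<noteq> 0"
    using insert.prems(2) insert.hyps by (intro kernel_trivial_pivot[of "insert e D"]) auto
  then obtain i where i: "i \<in> I" "c i e \<noteq> 0" by blast
  have "kernel_trivial (eliminate c i e) I D"
    using kernel_trivial_eliminate[of D e i I c] insert i by blast
  \<comment> \<open>The pivot row has become zero, so it is dropped along with its column.\<close>
  then have "kernel_trivial (eliminate c i e) (I - {i}) D"
    unfolding kernel_trivial_def
  proof (elim all_forward impCE')
    fix f assume nf: "\<not> (\<forall>j\<in>I. (\<Sum>e'\<in>D. eliminate c i e j e' * f e') = 0)"
    have "(\<Sum>e'\<in>D. eliminate c i e i e' * f e') = 0" by (simp add: eliminate_def)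
    then show "(\<forall>j\<in>I - {i}. (\<Sum>e'\<in>D. eliminate c i e j e' * f e') = 0) \<longrightarrow> (\<forall>e\<in>D. f e = 0)"
      using nf by blast
  qed blast
  then have "card D \<le> card (I - {i})" using insert.prems(1) by (intro insert.IH) auto
  then show ?case using insert i(1) by (simp add: card_Diff_singleton) 
    (metis Suc_leI Suc_pred card_gt_0_iff empty_iff le_imp_less_Suc)
qed simp

text \<open>
  Triviality of the kernel is an open condition. The witness \<open>\<delta>\<close>, the product of the
  pivots of a fraction-free Gaussian elimination, plays the role of a maximal minor.
\<close>

lemma kernel_trivial_open:
  fixes l :: "'i \<Rightarrow> 'e \<Rightarrow> 'r::comm_ring_1" and \<phi> :: "'r \<Rightarrow> 'a::field"
  assumes "finite D" "is_ring_hom \<phi>"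
    and "1 \<in> S" "\<And>x y. x \<in> S \<Longrightarrow> y \<in> S \<Longrightarrow> x - y \<in> S" "\<And>x y. x \<in> S \<Longrightarrow> y \<in> S \<Longrightarrow> x * y \<in> S"
    and "\<And>i e. i \<in> I \<Longrightarrow> e \<in> D \<Longrightarrow> l i e \<in> S"
    and "kernel_trivial (\<lambda>i e. \<phi> (l i e)) I D"
  shows "\<exists>\<delta>\<in>S. \<phi> \<delta> \<noteq> 0 \<and>
    (\<forall>\<psi> :: 'r \<Rightarrow> 'a. is_ring_hom \<psi> \<longrightarrow> \<psi> \<delta> \<noteq> 0 \<longrightarrow> kernel_trivial (\<lambda>i e. \<psi> (l i e)) I D)"
  using assms(1,6,7)
proof (induction D arbitrary: l rule: finite_induct)
  case empty
  show ?case using assms(2,3)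
    by (intro bexI[of _ 1]) (auto simp: kernel_trivial_def is_ring_hom_def)
next
  case (insert e D)
  have hom_elim: "(\<lambda>j e'. \<psi> (eliminate l i e j e')) = eliminate (\<lambda>j e'. \<psi> (l j e')) i e"
    if "is_ring_hom \<psi>" for \<psi> :: "'r \<Rightarrow> 'a" and i
    using that by (auto simp: eliminate_def is_ring_hom_def fun_eq_iff)
  have "\<exists>i\<in>I. \<phi> (l i e) \<noteq> 0"
    using insert.prems(2) insert.hyps(1) by (intro kernel_trivial_pivot[of "insert e D"]) auto
  then obtain i where i: "i \<in> I" "\<phi> (l i e) \<noteq> 0" by blast
  have "\<exists>\<delta>\<in>S. \<phi> \<delta> \<noteq> 0 \<and> (\<forall>\<psi> :: 'r \<Rightarrow> 'a. is_ring_hom \<psi> \<longrightarrow> \<psi> \<delta> \<noteq> 0 \<longrightarrow>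
      kernel_trivial (\<lambda>j e'. \<psi> (eliminate l i e j e')) I D)"
  proof (rule insert.IH)
    show "eliminate l i e j e' \<in> S" if "j \<in> I" "e' \<in> D" for j e'
      using assms(4,5) insert.prems(1) i(1) that by (simp add: eliminate_def)
    show "kernel_trivial (\<lambda>j e'. \<phi> (eliminate l i e j e')) I D"
      unfolding hom_elim[OF assms(2)]
      using kernel_trivial_eliminate[of D e i I "\<lambda>j e'. \<phi> (l j e')"] insert i by blast
  qed
  then obtain \<delta> where \<delta>: "\<delta> \<in> S" "\<phi> \<delta> \<noteq> 0"
    "\<And>\<psi> :: 'r \<Rightarrow> 'a. is_ring_hom \<psi> \<Longrightarrow> \<psi> \<delta> \<noteq> 0 \<Longrightarrow>
      kernel_trivial (\<lambda>j e'. \<psi> (eliminate l i e j e')) I D"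
    by blast
  show ?case
  proof (intro bexI[of _ "l i e * \<delta>"] conjI allI impI)
    show "l i e * \<delta> \<in> S" using assms(5) insert.prems(1) i(1) \<delta>(1) by simp
    show "\<phi> (l i e * \<delta>) \<noteq> 0" using assms(2) i(2) \<delta>(2) by (simp add: is_ring_hom_def)
    fix \<psi> :: "'r \<Rightarrow> 'a" assume \<psi>: "is_ring_hom \<psi>" "\<psi> (l i e * \<delta>) \<noteq> 0"
    then have "\<psi> (l i e) \<noteq> 0" "\<psi> \<delta> \<noteq> 0" by (auto simp: is_ring_hom_def)
    then show "kernel_trivial (\<lambda>i e. \<psi> (l i e)) I (insert e D)"
      using kernel_trivial_eliminate[of D e i I "\<lambda>j e'. \<psi> (l j e')"]
        \<delta>(3)[OF \<psi>(1)] hom_elim[OF \<psi>(1), of i] insert.hyps i(1) by simp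
  qed
qed

text \<open>The entries are monomials in \<open>s\<close>, and the matrix in the assumption is their
  value at \<open>s = 0\<close>. The witness of openness is a polynomial in \<open>s\<close> that is
  nonzero at \<open>0\<close>; it has finitely many zeros, and the field is infinite.\<close>

lemma kernel_trivial_degeneration:
  fixes c :: "'i \<Rightarrow> 'e \<Rightarrow> 'a::field_char_0" and n :: "'i \<Rightarrow> 'e \<Rightarrow> nat"
  assumes "finite D" "kernel_trivial (\<lambda>i e. if n i e = 0 then c i e else 0) I D"
  shows "\<exists>s. s \<noteq> 0 \<and> kernel_trivial (\<lambda>i e. c i e * s ^ n i e) I D"
proof -
  define l where "l i e = monom (c i e) (n i e)" for i e
  have hom: "is_ring_hom (\<lambda>p. poly p s)" for s :: 'a
    by (simp add: is_ring_hom_def)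
  have l0: "(\<lambda>i e. poly (l i e) 0) = (\<lambda>i e. if n i e = 0 then c i e else 0)"
    by (auto simp: l_def poly_monom fun_eq_iff)
  obtain \<delta> where \<delta>: "poly \<delta> 0 \<noteq> 0"
    "\<And>s. poly \<delta> s \<noteq> 0 \<Longrightarrow> kernel_trivial (\<lambda>i e. poly (l i e) s) I D"
    using kernel_trivial_open[OF assms(1) hom[of 0], of UNIV I l] assms(2) hom
    unfolding l0 by auto
  have "finite ({s. poly \<delta> s = 0} \<union> {0})"
    using \<delta>(1) poly_roots_finite[of \<delta>] by (cases "\<delta> = 0") auto
  then obtain s where "s \<notin> {s. poly \<delta> s = 0} \<union> {0}"
    using infinite_UNIV_char_0 ex_new_if_finite by blast
  then show ?thesis using \<delta>(2)[of s] by (auto simp: l_def poly_monom)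
qed

subsection \<open>Polynomial functions on exponents\<close>

text \<open>The degree bound is strict, so that it equals the multiplicity of the point whose
  conditions these functions express. Working with functions instead of polynomials makes rule
  induction available.\<close>

inductive poly_fun :: "nat \<Rightarrow> (nat \<times> nat \<Rightarrow> 'a::comm_ring_1) \<Rightarrow> bool" where
  zero: "poly_fun n (\<lambda>_. 0)"
| const: "poly_fun (Suc n) (\<lambda>_. c)"
| add: "poly_fun n p \<Longrightarrow> poly_fun n q \<Longrightarrow> poly_fun n (\<lambda>e. p e + q e)"
| fst: "poly_fun n q \<Longrightarrow> poly_fun (Suc n) (\<lambda>e. of_nat (fst e) * q e)"
| snd: "poly_fun n q \<Longrightarrow> poly_fun (Suc n) (\<lambda>e. of_nat (snd e) * q e)"

lemma poly_fun_0: "poly_fun n q \<Longrightarrow> n = 0 \<Longrightarrow> q e = 0"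
  by (induction rule: poly_fun.induct) auto

lemma poly_fun_Suc: "poly_fun n q \<Longrightarrow> poly_fun (Suc n) q"
  by (induction rule: poly_fun.induct) (auto intro: poly_fun.intros)

lemma poly_fun_mono:
  assumes "poly_fun n q" "n \<le> n'"
  shows "poly_fun n' q"
  using assms(2,1) by (induction n' rule: dec_induct) (auto intro: poly_fun_Suc)

lemma poly_fun_cmult: "poly_fun n q \<Longrightarrow> poly_fun n (\<lambda>e. c * q e)"
proof (induction rule: poly_fun.induct)
  case (add n p q)
  then show ?case using poly_fun.add by (fastforce simp: distrib_left)
next
  case (fst n q)
  then show ?case using poly_fun.fst by (fastforce simp: mult.left_commute)
next
  case (snd n q)
  then show ?case using poly_fun.snd by (fastforce simp: mult.left_commute)
qed (auto intro: poly_fun.intros)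

lemma poly_fun_diff: "poly_fun n p \<Longrightarrow> poly_fun n q \<Longrightarrow> poly_fun n (\<lambda>e. p e - q e)"
  using poly_fun.add[of n p "\<lambda>e. - 1 * q e"] poly_fun_cmult[of n q "- 1"] by simp

lemma poly_fun_sum:
  "finite A \<Longrightarrow> (\<And>i. i \<in> A \<Longrightarrow> poly_fun n (q i)) \<Longrightarrow> poly_fun n (\<lambda>e. \<Sum>i\<in>A. q i e)"
  by (induction A rule: finite_induct) (auto intro: poly_fun.intros)

lemma poly_fun_fst_diff: "poly_fun n q \<Longrightarrow> poly_fun (Suc n) (\<lambda>e. (of_nat (fst e) - c) * q e)"
  using poly_fun_diff[OF poly_fun.fst poly_fun_Suc[OF poly_fun_cmult]]
  by (fastforce simp: algebra_simps)

lemma poly_fun_snd_diff: "poly_fun n q \<Longrightarrow> poly_fun (Suc n) (\<lambda>e. (of_nat (snd e) - c) * q e)"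
  using poly_fun_diff[OF poly_fun.snd poly_fun_Suc[OF poly_fun_cmult]]
  by (fastforce simp: algebra_simps)

lemma poly_fun_power:
  "poly_fun (Suc (u + v)) (\<lambda>e. (of_nat (fst e) - c) ^ u * of_nat (snd e) ^ v)"
proof (induction u)
  case 0
  show ?case
  proof (induction v)
    case (Suc v)
    then show ?case using poly_fun.snd by fastforce
  qed (auto intro: poly_fun.intros)
next
  case (Suc u)
  then show ?case using poly_fun_fst_diff by (fastforce simp: mult.assoc)
qed

lemma poly_fun_prod_snd_diff:
  "finite Y \<Longrightarrow> poly_fun (Suc (card Y)) (\<lambda>e. \<Prod>y\<in>Y. of_nat (snd e) - c y)"
  by (induction Y rule: finite_induct) (auto intro: poly_fun.intros poly_fun_snd_diff)

text \<open>Division with remainder by the equation of the column \<open>\<alpha>\<close>: the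
  remainder is the restriction to that column and the quotient loses one degree.\<close>

lemma poly_fun_divide:
  assumes "poly_fun n q"
  shows "\<exists>r. poly_fun (n - 1) r \<and>
    (\<forall>a b. q (a, b) = q (\<alpha>, b) + (of_nat a - of_nat \<alpha>) * r (a, b))"
  using assms
proof (induction rule: poly_fun.induct)
  case (zero n)
  show ?case by (intro exI[of _ "\<lambda>_. 0"]) (auto intro: poly_fun.intros)
next
  case (const n c)
  show ?case by (intro exI[of _ "\<lambda>_. 0"]) (auto intro: poly_fun.intros)
next
  case (add n p q)
  then obtain r r' where r: "poly_fun (n - 1) r" "poly_fun (n - 1) r'"
    "\<And>a b. p (a, b) = p (\<alpha>, b) + (of_nat a - of_nat \<alpha>) * r (a, b)"
    "\<And>a b. q (a, b) = q (\<alpha>, b) + (of_nat a - of_nat \<alpha>) * r' (a, b)"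
    by metis
  have eq: "p (a, b) + q (a, b) =
      (p (\<alpha>, b) + (of_nat a - of_nat \<alpha>) * r (a, b)) +
      (q (\<alpha>, b) + (of_nat a - of_nat \<alpha>) * r' (a, b))" for a b
    by (rule arg_cong2[of _ _ _ _ "(+)"]) (rule r)+
  show ?case
  proof (intro exI[of _ "\<lambda>e. r e + r' e"] conjI allI)
    show "poly_fun (n - 1) (\<lambda>e. r e + r' e)" by (rule poly_fun.add[OF r(1,2)])
    show "p (a, b) + q (a, b) = p (\<alpha>, b) + q (\<alpha>, b) +
        (of_nat a - of_nat \<alpha>) * (r (a, b) + r' (a, b))" for a b
      by (simp only: eq[of a b] distrib_left add.assoc add.left_commute)
  qed
next
  case (fst n q)
  then obtain r where r: "poly_fun (n - 1) r"
    "\<And>a b. q (a, b) = q (\<alpha>, b) + (of_nat a - of_nat \<alpha>) * r (a, b)"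
    by metis
  have 1: "poly_fun n (\<lambda>e. q e + of_nat \<alpha> * r e)"
    using fst.hyps poly_fun_mono[OF poly_fun_cmult[OF r(1)]] by (auto intro: poly_fun.add)
  have 2: "of_nat a * q (a, b) =
      of_nat \<alpha> * q (\<alpha>, b) + (of_nat a - of_nat \<alpha>) * (q (a, b) + of_nat \<alpha> * r (a, b))" for a b
    using arg_cong[OF r(2)[of a b], of "\<lambda>z. of_nat \<alpha> * z"] by (simp add: algebra_simps)
  show ?case
    by (intro exI[of _ "\<lambda>e. q e + of_nat \<alpha> * r e"] conjI allI)
      (simp_all only: fst_conv diff_Suc_1 1 flip: 2)
next
  case (snd n q)
  then obtain r where r: "poly_fun (n - 1) r"
    "\<And>a b. q (a, b) = q (\<alpha>, b) + (of_nat a - of_nat \<alpha>) * r (a, b)"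
    by metis
  show ?case
  \<comment> \<open>For \<open>n = 0\<close> truncated subtraction leaves no degree for the factor
    \<open>snd e\<close>, but then \<open>q\<close> is zero.\<close>
  proof (cases n)
    case 0
    then show ?thesis using poly_fun_0[OF snd.hyps]
      by (intro exI[of _ "\<lambda>_. 0"]) (auto intro: poly_fun.intros)
  next
    case (Suc n')
    have 1: "poly_fun n (\<lambda>e. of_nat (snd e) * r e)"
      using poly_fun.snd[OF r(1)] Suc by simp
    have 2: "of_nat b * q (a, b) =
        of_nat b * q (\<alpha>, b) + (of_nat a - of_nat \<alpha>) * (of_nat b * r (a, b))" for a b
      using arg_cong[OF r(2)[of a b], of "\<lambda>z. of_nat b * z"] by (simp add: algebra_simps)
    show ?thesis
      by (intro exI[of _ "\<lambda>e. of_nat (snd e) * r e"] conjI allI)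
        (simp_all only: fst_conv snd_conv diff_Suc_1 1 flip: 2)
  qed
qed

lemma poly_fun_column:
  assumes "poly_fun n q"
  shows "\<exists>p. (\<forall>b. q (\<alpha>, b) = poly p (of_nat b)) \<and> (p = 0 \<or> degree p < n)"
  using assms
proof (induction rule: poly_fun.induct)
  case (zero n)
  show ?case by (intro exI[of _ 0]) auto
next
  case (const n c)
  show ?case by (intro exI[of _ "[:c:]"]) auto
next
  case (add n q r)
  then obtain p p' where "\<And>b. q (\<alpha>, b) = poly p (of_nat b)" "p = 0 \<or> degree p < n"
    "\<And>b. r (\<alpha>, b) = poly p' (of_nat b)" "p' = 0 \<or> degree p' < n"
    by metis
  then show ?case by (intro exI[of _ "p + p'"]) (auto intro: degree_add_less)
next
  case (fst n q)
  then obtain p where "\<And>b. q (\<alpha>, b) = poly p (of_nat b)" "p = 0 \<or> degree p < n"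
    by metis
  then show ?case
    by (intro exI[of _ "smult (of_nat \<alpha>) p"])
      (auto intro: le_less_trans[OF degree_smult_le])
next
  case (snd n q)
  then obtain p where "\<And>b. q (\<alpha>, b) = poly p (of_nat b)" "p = 0 \<or> degree p < n"
    by metis
  then show ?case
    by (intro exI[of _ "pCons 0 p"]) (auto simp: degree_pCons_eq)
qed

text \<open>A nonzero univariate polynomial of degree less than \<open>n\<close> cannot have
  \<open>n\<close> roots; in characteristic 0 the natural numbers in \<open>Y\<close> stay distinct
  in the field.\<close>

lemma poly_fun_column_zero:
  fixes q :: "nat \<times> nat \<Rightarrow> 'a::field_char_0"
  assumes "poly_fun n q" "finite Y" "n \<le> card Y" "\<And>b. b \<in> Y \<Longrightarrow> q (\<alpha>, b) = 0"
  shows "q (\<alpha>, b) = 0"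
proof -
  obtain p :: "'a poly" where p: "\<And>b. q (\<alpha>, b) = poly p (of_nat b)" "p = 0 \<or> degree p < n"
    using poly_fun_column[OF assms(1)] by blast
  have "p = 0"
  proof (rule ccontr)
    assume "p \<noteq> 0"
    have "card Y = card (of_nat ` Y :: 'a set)"
      by (simp add: card_image inj_on_def)
    also have "\<dots> \<le> card {x. poly p x = 0}"
      using assms(4) p(1) poly_roots_finite[OF \<open>p \<noteq> 0\<close>] by (intro card_mono) auto
    also have "\<dots> \<le> degree p" by (rule card_poly_roots_bound[OF \<open>p \<noteq> 0\<close>])
    finally show False using p(2) assms(3) \<open>p \<noteq> 0\<close> by simp
  qed
  then show ?thesis using p(1) by simp
qed

lemma poly_fun_divide_column:
  fixes q :: "nat \<times> nat \<Rightarrow> 'a::field_char_0"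
  assumes "poly_fun (Suc n) q" "finite Y" "Suc n \<le> card Y" "\<And>b. b \<in> Y \<Longrightarrow> q (\<alpha>, b) = 0"
  shows "\<exists>r. poly_fun n r \<and> (\<forall>a b. q (a, b) = (of_nat a - of_nat \<alpha>) * r (a, b))"
  using poly_fun_divide[OF assms(1), of \<alpha>] poly_fun_column_zero[OF assms] by auto

text \<open>Peel off the columns \<open>\<alpha> m\<close>, ..., \<open>\<alpha> (j + 1)\<close>,
  the longest first. Each has as many zeros as the current degree bound, so its equation divides the
  function, and the bound drops by one for the next column. What is left has degree less than
  \<open>j\<close> and \<open>j\<close> zeros in column \<open>a\<close>.\<close>

lemma poly_fun_vanish_on_column:
  fixes q :: "nat \<times> nat \<Rightarrow> 'a::field_char_0"
  assumes "poly_fun m q" "j \<le> m" "inj_on \<alpha> {j<..m}" "a \<notin> \<alpha> ` {j<..m}"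
    and "\<And>t. t \<in> {j<..m} \<Longrightarrow> finite (X t) \<and> card (X t) = t \<and> (\<forall>\<beta>\<in>X t. q (\<alpha> t, \<beta>) = 0)"
    and "finite Y" "card Y = j" "\<And>\<beta>. \<beta> \<in> Y \<Longrightarrow> q (a, \<beta>) = 0"
  shows "q (a, \<beta>) = 0"
  using assms
proof (induction m arbitrary: q)
  case 0
  then show ?case using poly_fun_0 by blast
next
  case (Suc m)
  show ?case
  proof (cases "j = Suc m")
    case True
    then show ?thesis using poly_fun_column_zero[OF Suc.prems(1), of Y] Suc.prems by auto
  next
    case False
    then have jm: "j \<le> m" "Suc m \<in> {j<..Suc m}" using Suc.prems(2) by auto
    have "\<exists>r. poly_fun m r \<and> (\<forall>a b. q (a, b) = (of_nat a - of_nat (\<alpha> (Suc m))) * r (a, b))"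
      using Suc.prems(5)[OF jm(2)]
      by (intro poly_fun_divide_column[OF Suc.prems(1), of "X (Suc m)"]) auto
    then obtain r where r: "poly_fun m r"
      "\<And>a b. q (a, b) = (of_nat a - of_nat (\<alpha> (Suc m))) * r (a, b)"
      by blast
    have neq: "\<alpha> t \<noteq> \<alpha> (Suc m)" if "t \<in> {j<..m}" for t
      using inj_onD[OF Suc.prems(3), of t "Suc m"] that jm by auto
    have an: "a \<noteq> \<alpha> (Suc m)" using Suc.prems(4) jm by blast
    have "r (a, \<beta>) = 0"
    proof (rule Suc.IH[OF r(1) jm(1)])
      show "inj_on \<alpha> {j<..m}" by (rule inj_on_subset[OF Suc.prems(3)]) auto
      show "a \<notin> \<alpha> ` {j<..m}" using Suc.prems(4) by auto
      show "finite (X t) \<and> card (X t) = t \<and> (\<forall>\<beta>\<in>X t. r (\<alpha> t, \<beta>) = 0)" if "t \<in> {j<..m}" for t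
        using Suc.prems(5)[of t] that neq[OF that] r(2) by auto
      show "r (a, \<beta>) = 0" if "\<beta> \<in> Y" for \<beta>
        using Suc.prems(8)[OF that] r(2) an by auto
    qed (use Suc.prems in auto)
    then show ?thesis using r(2) by simp
  qed
qed

text \<open>Newton interpolation by columns, the longest added last: multiplying by the equation of
  the new column keeps the earlier dual functions, and Lagrange polynomials in the second exponent
  serve the new column.\<close>

lemma poly_fun_dual_basis:
  assumes "inj_on \<alpha> {1..m}" "\<And>t. t \<in> {1..m} \<Longrightarrow> finite (X t) \<and> card (X t) = t"
    and "b\<^sub>0 \<in> (\<Union>t\<in>{1..m}. {\<alpha> t} \<times> X t)"
  shows "\<exists>q :: nat \<times> nat \<Rightarrow> 'a::field_char_0. poly_fun m q \<and>
    (\<forall>b\<in>(\<Union>t\<in>{1..m}. {\<alpha> t} \<times> X t). q b = (if b = b\<^sub>0 then 1 else 0))"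
  using assms
proof (induction m arbitrary: b\<^sub>0)
  case 0
  then show ?case by auto
next
  case (Suc m)
  define B where "B = (\<Union>t\<in>{1..m}. {\<alpha> t} \<times> X t)"
  define C where "C = {\<alpha> (Suc m)} \<times> X (Suc m)"
  have BC: "(\<Union>t\<in>{1..Suc m}. {\<alpha> t} \<times> X t) = B \<union> C"
    by (auto simp: B_def C_def atLeastAtMostSuc_conv)
  have finB: "finite B" using Suc.prems(2) by (auto simp: B_def)
  have X: "finite (X (Suc m))" "card (X (Suc m)) = Suc m" using Suc.prems(2)[of "Suc m"] by auto
  have B_neq: "fst b \<noteq> \<alpha> (Suc m)" if b: "b \<in> B" for b
  proof -
    obtain t where "t \<in> {1..m}" "fst b = \<alpha> t" using b by (auto simp: B_def)
    then show ?thesis using inj_onD[OF Suc.prems(1), of t "Suc m"] by auto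
  qed
  have "\<exists>q :: nat \<times> nat \<Rightarrow> 'a. poly_fun (Suc m) q \<and> (\<forall>b\<in>B \<union> C. q b = (if b = b1 then 1 else 0))"
    if b1: "b1 \<in> B" for b1
  proof -
    have "\<exists>q :: nat \<times> nat \<Rightarrow> 'a. poly_fun m q \<and> (\<forall>b\<in>B. q b = (if b = b1 then 1 else 0))"
      unfolding B_def
    proof (rule Suc.IH)
      show "inj_on \<alpha> {1..m}" by (rule inj_on_subset[OF Suc.prems(1)]) auto
      show "finite (X t) \<and> card (X t) = t" if "t \<in> {1..m}" for t
        using Suc.prems(2)[of t] that by simp
      show "b1 \<in> (\<Union>t\<in>{1..m}. {\<alpha> t} \<times> X t)" using b1 by (simp add: B_def)
    qed
    then obtain q :: "nat \<times> nat \<Rightarrow> 'a"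
      where q: "poly_fun m q" "\<forall>b\<in>B. q b = (if b = b1 then 1 else 0)" by blast
    define r where "r = (\<lambda>e. inverse (of_nat (fst b1) - of_nat (\<alpha> (Suc m))) *
      ((of_nat (fst e) - of_nat (\<alpha> (Suc m))) * q e))"
    have "poly_fun (Suc m) r"
      unfolding r_def by (intro poly_fun_cmult poly_fun_fst_diff q(1))
    moreover have "r b = (if b = b1 then 1 else 0)" if "b \<in> B \<union> C" for b
      using that q(2) b1 B_neq[OF b1] by (auto simp: r_def C_def)
    ultimately show ?thesis by blast
  qed
  then obtain Q :: "nat \<times> nat \<Rightarrow> nat \<times> nat \<Rightarrow> 'a" where
    Q: "\<And>b1. b1 \<in> B \<Longrightarrow> poly_fun (Suc m) (Q b1)"
    "\<And>b1 b. b1 \<in> B \<Longrightarrow> b \<in> B \<union> C \<Longrightarrow> Q b1 b = (if b = b1 then 1 else 0)"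
    by metis
  show ?case
    unfolding BC
  proof (cases "b\<^sub>0 \<in> B")
    case True
    then show "\<exists>q :: nat \<times> nat \<Rightarrow> 'a. poly_fun (Suc m) q \<and>
      (\<forall>b\<in>B \<union> C. q b = (if b = b\<^sub>0 then 1 else 0))" using Q by blast
  next
    case False
    then have "b\<^sub>0 \<in> C" using Suc.prems(3) BC by auto
    then obtain \<beta> where \<beta>: "b\<^sub>0 = (\<alpha> (Suc m), \<beta>)" "\<beta> \<in> X (Suc m)" by (auto simp: C_def)
    define L :: "nat \<times> nat \<Rightarrow> 'a" where
      "L = (\<lambda>e. inverse (\<Prod>y\<in>X (Suc m) - {\<beta>}. of_nat \<beta> - of_nat y) *
        (\<Prod>y\<in>X (Suc m) - {\<beta>}. of_nat (snd e) - of_nat y))"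
    have L: "poly_fun (Suc m) L"
      using poly_fun_prod_snd_diff[of "X (Suc m) - {\<beta>}" of_nat] X \<beta>(2)
      unfolding L_def by (intro poly_fun_cmult) simp
    have LC: "L b = (if b = b\<^sub>0 then 1 else 0)" if "b \<in> C" for b
      using that X \<beta> by (auto simp: L_def C_def prod_zero_iff)
    \<comment> \<open>The correction kills \<open>L\<close> on \<open>B\<close> and leaves it alone
      on \<open>C\<close>, where every \<open>Q b1\<close> vanishes.\<close>
    define q where "q = (\<lambda>e. L e - (\<Sum>b1\<in>B. L b1 * Q b1 e))"
    have "poly_fun (Suc m) q"
      unfolding q_def by (intro poly_fun_diff poly_fun_sum poly_fun_cmult L Q(1) finB)
    moreover have "q b = (if b = b\<^sub>0 then 1 else 0)" if b: "b \<in> B \<union> C" for b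
    proof (cases "b \<in> B")
      case True
      have "(\<Sum>b1\<in>B. L b1 * Q b1 b) = (\<Sum>b1\<in>B. if b1 = b then L b1 else 0)"
        using Q(2)[OF _ b] by (intro sum.cong) auto
      then show ?thesis using True False finB by (auto simp: q_def)
    next
      case nB: False
      have "(\<Sum>b1\<in>B. L b1 * Q b1 b) = 0"
        using Q(2)[OF _ b] nB by (intro sum.neutral) auto
      then show ?thesis using b nB LC by (simp add: q_def)
    qed
    ultimately show "\<exists>q :: nat \<times> nat \<Rightarrow> 'a. poly_fun (Suc m) q \<and>
      (\<forall>b\<in>B \<union> C. q b = (if b = b\<^sub>0 then 1 else 0))" by blast
  qed
qed

subsection \<open>Degeneration of one point\<close>

definition jet_coeff :: "('a \<times> 'a) \<times> nat \<times> nat \<Rightarrow> nat \<times> nat \<Rightarrow> 'a::comm_ring_1" where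
  "jet_coeff = (\<lambda>((x, y), u, v) (a, b). of_nat a ^ u * of_nat b ^ v * (x ^ a * y ^ b))"

text \<open>
  In characteristic 0 and away from the coordinate axes, the conditions \<^const>\<open>jet_coeff\<close>
  with \<open>u + v < m\<close> say that a polynomial with exponents in \<open>D\<close> vanishes to order \<open>m\<close>,
  since the operators \<open>x \<partial>/\<partial>x\<close> and \<open>y \<partial>/\<partial>y\<close> act diagonally on monomials.
\<close>

definition interpolates :: "nat \<Rightarrow> ('a::comm_ring_1 \<times> 'a) set \<Rightarrow> (nat \<times> nat) set \<Rightarrow> bool" where
  "interpolates m X D \<longleftrightarrow>
     kernel_trivial jet_coeff (X \<times> {(u, v). u + v < m}) D"

lemma interpolatesD:
  assumes "interpolates m X D" "e \<in> D"
    and "\<And>j. j \<in> X \<times> {(u, v). u + v < m} \<Longrightarrow> (\<Sum>e\<in>D. jet_coeff j e * f e) = 0"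
  shows "f e = 0"
  using assms unfolding interpolates_def kernel_trivial_def by blast

text \<open>One configuration is enough because the condition is open. The points form a list, so
  that they can be counted without having to be distinct.\<close>

definition nondegenerate ::
  "'a::field_char_0 itself \<Rightarrow> nat \<Rightarrow> nat \<Rightarrow> (nat \<times> nat) set \<Rightarrow> bool" where
  "nondegenerate K m s D \<longleftrightarrow> finite D \<and>
     (\<exists>xs :: ('a \<times> 'a) list. length xs = s \<and> (\<forall>p\<in>set xs. fst p \<noteq> 0 \<and> snd p \<noteq> 0) \<and>
        interpolates m (set xs) D)"

lemma jet_coeff_poly_fun:
  fixes x y :: "'a::comm_ring_1"
  assumes "\<And>u v. u + v < m \<Longrightarrow> (\<Sum>e\<in>D. jet_coeff ((x, y), u, v) e * f e) = 0" "poly_fun m q"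
  shows "(\<Sum>e\<in>D. q e * (x ^ fst e * y ^ snd e) * f e) = 0"
proof -
  \<comment> \<open>The function \<open>g\<close> has to vary in the induction: a factor
    \<open>fst e\<close> or \<open>snd e\<close> of \<open>q\<close> is moved into it.\<close>
  have "(\<Sum>e\<in>D. q e * g e) = 0"
    if "\<And>u v. u + v < m \<Longrightarrow> (\<Sum>e\<in>D. of_nat (fst e) ^ u * of_nat (snd e) ^ v * g e) = 0"
    for g :: "nat \<times> nat \<Rightarrow> 'a"
    using assms(2) that
  proof (induction arbitrary: g rule: poly_fun.induct)
    case (const n c)
    then show ?case using const[of 0 0] by (simp flip: sum_distrib_left)
  next
    case (add n p q)
    then show ?case by (simp add: distrib_right sum.distrib)
  next
    case (fst n q)
    have "(\<Sum>e\<in>D. q e * (of_nat (fst e) * g e)) = 0"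
      using fst.prems[of "Suc _"] by (intro fst.IH) (simp add: ac_simps)
    then show ?case by (simp add: ac_simps)
  next
    case (snd n q)
    have "(\<Sum>e\<in>D. q e * (of_nat (snd e) * g e)) = 0"
      using snd.prems[of _ "Suc _"] by (intro snd.IH) (simp add: ac_simps)
    then show ?case by (simp add: ac_simps)
  qed simp
  from this[of "\<lambda>e. x ^ fst e * y ^ snd e * f e"] show ?thesis
    using assms(1) by (simp add: jet_coeff_def case_prod_beta mult.assoc)
qed

lemma nondegenerate_empty: "nondegenerate K m 0 {}"
  by (auto simp: nondegenerate_def interpolates_def kernel_trivial_def)

lemma power_int_weight:
  fixes s :: "'a::field"
  assumes "s \<noteq> 0"
  shows "(s powi u) ^ a * (s powi v) ^ b = s powi (u * int a + v * int b)"
  using assms by (simp add: power_int_add power_int_mult)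

text \<open>
  The new point is \<open>(s\<^sup>u, s\<^sup>v)\<close> with \<open>s\<close> close to \<open>0\<close>: after rescaling, its conditions
  degenerate to the vanishing of the coefficients in \<open>B\<close>.
\<close>

lemma nondegenerate_add_point:
  fixes q :: "nat \<times> nat \<Rightarrow> nat \<times> nat \<Rightarrow> 'a::field_char_0" and u v :: int
  defines "w \<equiv> \<lambda>e. u * int (fst e) + v * int (snd e)"
  assumes "finite B" "B \<inter> D = {}" "nondegenerate TYPE('a) m s D"
    and q: "\<And>b. b \<in> B \<Longrightarrow> poly_fun m (q b)"
    and dual: "\<And>b b'. b \<in> B \<Longrightarrow> b' \<in> B \<Longrightarrow> q b b' = (if b' = b then 1 else 0)"
    and less: "\<And>b e. b \<in> B \<Longrightarrow> e \<in> D \<Longrightarrow> q b e \<noteq> 0 \<Longrightarrow> w b < w e"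
  shows "nondegenerate TYPE('a) m (Suc s) (B \<union> D)"
proof -
  obtain xs :: "('a \<times> 'a) list" where xs: "length xs = s"
    "\<forall>p\<in>set xs. fst p \<noteq> 0 \<and> snd p \<noteq> 0" "interpolates m (set xs) D"
    using assms(4) by (auto simp: nondegenerate_def)
  have finD: "finite D" using assms(4) by (simp add: nondegenerate_def)
  define J where "J = set xs \<times> {(u, v). u + v < m}"
  define c where "c i e = (case i of Inl b \<Rightarrow> q b e | Inr j \<Rightarrow> jet_coeff j e)"
    for i :: "nat \<times> nat + ('a \<times> 'a) \<times> nat \<times> nat" and e
  \<comment> \<open>The power of \<open>s\<close> left at \<open>e\<close> when row \<open>b\<close>
    is divided by \<open>s\<close> to the power \<open>w b\<close>. Within \<open>B\<close> it may
    be set to 0, as \<open>q b\<close> vanishes there except at \<open>b\<close> itself. On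
    \<open>D\<close>, by assumption \<open>less\<close>, \<open>nat\<close> truncates only where
    \<open>q b e = 0\<close>.\<close>
  define n where "n i e = (case i of Inl b \<Rightarrow> if e \<in> B then 0 else nat (w e - w b) | Inr j \<Rightarrow> 0)"
    for i :: "nat \<times> nat + ('a \<times> 'a) \<times> nat \<times> nat" and e
  have [simp]: "n (Inr j) e = 0" "c (Inr j) e = jet_coeff j e" for j e
    by (simp_all add: n_def c_def)
  \<comment> \<open>At \<open>s = 0\<close> the row of \<open>b\<close> is the unit vector at
    \<open>b\<close>; once the coefficients on \<open>B\<close> vanish, the old points take care of
    \<open>D\<close>.\<close>
  have "kernel_trivial (\<lambda>i e. if n i e = 0 then c i e else 0) (Inl ` B \<union> Inr ` J) (B \<union> D)"
    unfolding kernel_trivial_def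
  proof (intro allI impI)
    fix f :: "nat \<times> nat \<Rightarrow> 'a"
    assume f: "\<forall>i\<in>Inl ` B \<union> Inr ` J. (\<Sum>e\<in>B \<union> D. (if n i e = 0 then c i e else 0) * f e) = 0"
    have fB: "f b = 0" if b: "b \<in> B" for b
    proof -
      have "(\<Sum>e\<in>B \<union> D. (if n (Inl b) e = 0 then c (Inl b) e else 0) * f e) =
          (\<Sum>e\<in>B \<union> D. if e = b then f e else 0)"
      proof (rule sum.cong)
        fix e assume "e \<in> B \<union> D"
        then show "(if n (Inl b) e = 0 then c (Inl b) e else 0) * f e = (if e = b then f e else 0)"
          using b assms(3) less[OF b, of e] dual[OF b, of e]
          by (cases "e \<in> B"; cases "q b e = 0") (auto simp: n_def c_def)
      qed simp
      then show ?thesis using f b assms(2) finD by (simp add: UnI1)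
    qed
    have "(\<Sum>e\<in>D. jet_coeff j e * f e) = 0" if "j \<in> J" for j
    proof -
      have "0 = (\<Sum>e\<in>B \<union> D. jet_coeff j e * f e)"
        using bspec[OF f, of "Inr j"] that by simp
      also have "\<dots> = (\<Sum>e\<in>D. jet_coeff j e * f e)"
        using assms(2) finD fB by (intro sum.mono_neutral_right) auto
      finally show ?thesis by simp
    qed
    then have "\<forall>e\<in>D. f e = 0"
      using xs(3) unfolding interpolates_def kernel_trivial_def J_def by blast
    then show "\<forall>e\<in>B \<union> D. f e = 0" using fB by blast
  qed
  then obtain \<sigma> where \<sigma>: "\<sigma> \<noteq> 0"
    "kernel_trivial (\<lambda>i e. c i e * \<sigma> ^ n i e) (Inl ` B \<union> Inr ` J) (B \<union> D)"
    using kernel_trivial_degeneration[of "B \<union> D" n c] assms(2) finD by auto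
  have "interpolates m (set ((\<sigma> powi u, \<sigma> powi v) # xs)) (B \<union> D)"
    unfolding interpolates_def kernel_trivial_def
  proof (intro allI impI)
    fix f :: "nat \<times> nat \<Rightarrow> 'a"
    assume f: "\<forall>j\<in>set ((\<sigma> powi u, \<sigma> powi v) # xs) \<times> {(u, v). u + v < m}.
      (\<Sum>e\<in>B \<union> D. jet_coeff j e * f e) = 0"
    have "(\<Sum>e\<in>B \<union> D. c (Inl b) e * \<sigma> ^ n (Inl b) e * f e) = 0" if b: "b \<in> B" for b
    proof -
      have "0 = (\<Sum>e\<in>B \<union> D. q b e * ((\<sigma> powi u) ^ fst e * (\<sigma> powi v) ^ snd e) * f e)"
        by (rule jet_coeff_poly_fun[OF _ q[OF b], symmetric]) (use f in auto)
      also have "\<dots> = (\<Sum>e\<in>B \<union> D. \<sigma> powi w b * (c (Inl b) e * \<sigma> ^ n (Inl b) e * f e))"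
      proof (rule sum.cong)
        fix e assume e: "e \<in> B \<union> D"
        show "q b e * ((\<sigma> powi u) ^ fst e * (\<sigma> powi v) ^ snd e) * f e =
          \<sigma> powi w b * (c (Inl b) e * \<sigma> ^ n (Inl b) e * f e)"
        proof (cases "q b e = 0")
          case False
          have "w e = w b + int (n (Inl b) e)"
            using e less[OF b, of e] dual[OF b, of e] False by (auto simp: n_def split: if_splits)
          then have "\<sigma> powi w e = \<sigma> powi w b * \<sigma> ^ n (Inl b) e"
            using \<sigma>(1) by (simp add: power_int_add)
          moreover have "(\<sigma> powi u) ^ fst e * (\<sigma> powi v) ^ snd e = \<sigma> powi w e"
            unfolding w_def by (rule power_int_weight[OF \<sigma>(1)])
          ultimately have "(\<sigma> powi u) ^ fst e * (\<sigma> powi v) ^ snd e = \<sigma> powi w b * \<sigma> ^ n (Inl b) e"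
            by simp
          then show ?thesis by (simp add: c_def)
        qed (simp add: c_def)
      qed simp
      finally show ?thesis using \<sigma>(1) by (simp flip: sum_distrib_left)
    qed
    moreover have "(\<Sum>e\<in>B \<union> D. c (Inr j) e * \<sigma> ^ n (Inr j) e * f e) = 0" if "j \<in> J" for j
      using bspec[OF f, of j] that by (auto simp: J_def)
    ultimately show "\<forall>e\<in>B \<union> D. f e = 0"
      using \<sigma>(2) unfolding kernel_trivial_def by blast
  qed
  then show ?thesis
    unfolding nondegenerate_def using assms(2) finD xs \<sigma>(1)
    by (intro conjI exI[of _ "(\<sigma> powi u, \<sigma> powi v) # xs"]) auto
qed

text \<open>Rescaling the points for \<open>A\<close> by \<open>(s\<^sup>u, s\<^sup>v)\<close> makes the system block triangular at \<open>s = 0\<close>.\<close>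

lemma nondegenerate_Un:
  fixes u v :: int
  defines "w \<equiv> \<lambda>e. u * int (fst e) + v * int (snd e)"
  assumes "nondegenerate TYPE('a::field_char_0) m s A" "nondegenerate TYPE('a) m t D"
    and "\<And>a e. a \<in> A \<Longrightarrow> e \<in> D \<Longrightarrow> w a < w e"
  shows "nondegenerate TYPE('a) m (s + t) (A \<union> D)"
proof -
  obtain xs ys :: "('a \<times> 'a) list" where xs: "length xs = s"
    "\<forall>p\<in>set xs. fst p \<noteq> 0 \<and> snd p \<noteq> 0" "interpolates m (set xs) A"
    and ys: "length ys = t"
    "\<forall>p\<in>set ys. fst p \<noteq> 0 \<and> snd p \<noteq> 0" "interpolates m (set ys) D"
    using assms(2,3) by (auto simp: nondegenerate_def)
  have fin: "finite A" "finite D" using assms(2,3) by (auto simp: nondegenerate_def)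
  \<comment> \<open>A threshold between the weights of \<open>A\<close> and those of
    \<open>D\<close>; it normalises all exponents of \<open>s\<close> to be nonnegative.\<close>
  obtain \<kappa> where \<kappa>: "\<And>a. a \<in> A \<Longrightarrow> w a \<le> \<kappa>" "\<And>e. e \<in> D \<Longrightarrow> \<kappa> < w e"
  proof (cases "A = {}")
    case True
    show ?thesis
    proof (cases "D = {}")
      case True
      then show ?thesis using that \<open>A = {}\<close> by blast
    next
      case False
      have "Min (w ` D) - 1 < w e" if "e \<in> D" for e
      proof -
        have "Min (w ` D) \<le> w e" using that fin by (intro Min_le) auto
        then show ?thesis by linarith
      qed
      then show ?thesis using that[of "Min (w ` D) - 1"] True by blast
    qed
  next
    case False
    show ?thesis using that[of "Max (w ` A)"] assms(4) False fin by auto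
  qed
  have disj: "A \<inter> D = {}" using assms(4) by fastforce
  define c where "c i e = jet_coeff (snd i) e"
    for i :: "bool \<times> ('a \<times> 'a) \<times> nat \<times> nat" and e
  \<comment> \<open>Rows marked \<open>True\<close> belong to the rescaled points and are divided by
    \<open>s\<close> to the power \<open>\<kappa>\<close>. Columns in \<open>A\<close> are divided
    by \<open>s\<close> to the power \<open>w e - \<kappa>\<close>, which is what \<open>g\<close>
    below undoes. At \<open>s = 0\<close> the \<open>True\<close> rows see only \<open>A\<close>,
    while the other rows are unchanged on \<open>D\<close>.\<close>
  define n where "n i e =
      (if fst i then (if e \<in> A then 0 else nat (w e - \<kappa>)) else (if e \<in> A then nat (\<kappa> - w e) else 0))"
    for i :: "bool \<times> ('a \<times> 'a) \<times> nat \<times> nat" and e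
  define I where "I = {True} \<times> set xs \<times> {(u, v). u + v < m} \<union> {False} \<times> set ys \<times> {(u, v). u + v < m}"
  have "kernel_trivial (\<lambda>i e. if n i e = 0 then c i e else 0) I (A \<union> D)"
    unfolding kernel_trivial_def
  proof (intro allI impI)
    fix f :: "nat \<times> nat \<Rightarrow> 'a"
    assume f: "\<forall>i\<in>I. (\<Sum>e\<in>A \<union> D. (if n i e = 0 then c i e else 0) * f e) = 0"
    have "(\<Sum>e\<in>A. jet_coeff j e * f e) = 0" if "j \<in> set xs \<times> {(u, v). u + v < m}" for j
    proof -
      have "0 = (\<Sum>e\<in>A \<union> D. (if n (True, j) e = 0 then c (True, j) e else 0) * f e)"
        using f that by (auto simp: I_def)
      also have "\<dots> = (\<Sum>e\<in>A. (if n (True, j) e = 0 then c (True, j) e else 0) * f e)"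
        using fin by (intro sum.mono_neutral_right) (auto simp: n_def dest!: \<kappa>(2))
      also have "\<dots> = (\<Sum>e\<in>A. jet_coeff j e * f e)"
        by (intro sum.cong) (auto simp: n_def c_def)
      finally show ?thesis by simp
    qed
    then have fA: "\<forall>e\<in>A. f e = 0"
      using xs(3) unfolding interpolates_def kernel_trivial_def by blast
    have "(\<Sum>e\<in>D. jet_coeff j e * f e) = 0" if "j \<in> set ys \<times> {(u, v). u + v < m}" for j
    proof -
      have "0 = (\<Sum>e\<in>A \<union> D. (if n (False, j) e = 0 then c (False, j) e else 0) * f e)"
        using f that by (auto simp: I_def)
      also have "\<dots> = (\<Sum>e\<in>D. (if n (False, j) e = 0 then c (False, j) e else 0) * f e)"
        using fin fA by (intro sum.mono_neutral_right) auto
      also have "\<dots> = (\<Sum>e\<in>D. jet_coeff j e * f e)"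
        using disj by (intro sum.cong) (auto simp: n_def c_def)
      finally show ?thesis by simp
    qed
    then have "\<forall>e\<in>D. f e = 0"
      using ys(3) unfolding interpolates_def kernel_trivial_def by blast
    then show "\<forall>e\<in>A \<union> D. f e = 0" using fA by blast
  qed
  then obtain \<sigma> where \<sigma>: "\<sigma> \<noteq> 0" "kernel_trivial (\<lambda>i e. c i e * \<sigma> ^ n i e) I (A \<union> D)"
    using kernel_trivial_degeneration[of "A \<union> D" n c I] fin by auto
  define zs where "zs = map (\<lambda>(x, y). (x * \<sigma> powi u, y * \<sigma> powi v)) xs @ ys"
  have "interpolates m (set zs) (A \<union> D)"
    unfolding interpolates_def kernel_trivial_def
  proof (intro allI impI)
    fix f :: "nat \<times> nat \<Rightarrow> 'a"
    assume f: "\<forall>j\<in>set zs \<times> {(u, v). u + v < m}. (\<Sum>e\<in>A \<union> D. jet_coeff j e * f e) = 0"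
    define g where "g e = (if e \<in> A then f e * \<sigma> powi (w e - \<kappa>) else f e)" for e
    have "(\<Sum>e\<in>A \<union> D. c i e * \<sigma> ^ n i e * g e) = 0" if i: "i \<in> I" for i
    proof (cases "fst i")
      case True
      obtain x y k l where ixy: "i = (True, (x, y), k, l)" by (cases i) (use True in auto)
      then have kl: "k + l < m" and "(x, y) \<in> set xs" using i by (auto simp: I_def)
      then have "(x * \<sigma> powi u, y * \<sigma> powi v) \<in> set zs" by (force simp: zs_def)
      then have "0 = (\<Sum>e\<in>A \<union> D. jet_coeff ((x * \<sigma> powi u, y * \<sigma> powi v), k, l) e * f e)"
        using f kl by simp
      also have "\<dots> = (\<Sum>e\<in>A \<union> D. \<sigma> powi \<kappa> * (c i e * \<sigma> ^ n i e * g e))"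
      proof (rule sum.cong)
        fix e assume e: "e \<in> A \<union> D"
        have "jet_coeff ((x * \<sigma> powi u, y * \<sigma> powi v), k, l) e = jet_coeff ((x, y), k, l) e * \<sigma> powi w e"
          using power_int_weight[OF \<sigma>(1), of u "fst e" v "snd e"]
          by (simp add: jet_coeff_def case_prod_beta w_def power_mult_distrib ac_simps)
        moreover have "\<sigma> powi w e * f e = \<sigma> powi \<kappa> * (\<sigma> ^ n i e * g e)"
        proof (cases "e \<in> A")
          case True
          have "\<sigma> powi w e = \<sigma> powi \<kappa> * \<sigma> powi (w e - \<kappa>)"
            using \<sigma>(1) by (simp flip: power_int_add)
          then show ?thesis using True by (simp add: n_def g_def ixy)
        next
          case False
          then have "w e = \<kappa> + int (n i e)" using e \<kappa>(2)[of e] by (auto simp: n_def ixy)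
          then have "\<sigma> powi w e = \<sigma> powi \<kappa> * \<sigma> ^ n i e"
            using \<sigma>(1) by (simp add: power_int_add)
          then show ?thesis using False by (simp add: g_def)
        qed
        ultimately show "jet_coeff ((x * \<sigma> powi u, y * \<sigma> powi v), k, l) e * f e =
            \<sigma> powi \<kappa> * (c i e * \<sigma> ^ n i e * g e)"
          by (simp add: c_def ixy mult.assoc mult.left_commute)
      qed simp
      finally show ?thesis using \<sigma>(1) by (simp flip: sum_distrib_left)
    next
      case False
      then have j: "snd i \<in> set ys \<times> {(u, v). u + v < m}" using i by (auto simp: I_def)
      have "(\<Sum>e\<in>A \<union> D. c i e * \<sigma> ^ n i e * g e) = (\<Sum>e\<in>A \<union> D. jet_coeff (snd i) e * f e)"
      proof (rule sum.cong)
        fix e assume e: "e \<in> A \<union> D"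
        have "\<sigma> ^ n i e * g e = f e"
        proof (cases "e \<in> A")
          case True
          then have "int (n i e) = \<kappa> - w e" using False \<kappa>(1) by (simp add: n_def)
          then have "\<sigma> ^ n i e * \<sigma> powi (w e - \<kappa>) = 1"
            using \<sigma>(1) by (simp flip: power_int_of_nat power_int_add)
          then show ?thesis using True by (simp add: g_def mult.left_commute)
        qed (use False in \<open>simp add: n_def g_def\<close>)
        then show "c i e * \<sigma> ^ n i e * g e = jet_coeff (snd i) e * f e"
          by (simp add: c_def mult.assoc)
      qed simp
      also have "\<dots> = 0" using f j by (auto simp: zs_def)
      finally show ?thesis .
    qed
    then have "\<forall>e\<in>A \<union> D. g e = 0"
      using \<sigma>(2) unfolding kernel_trivial_def by blast
    then show "\<forall>e\<in>A \<union> D. f e = 0" using \<sigma>(1) by (auto simp: g_def split: if_splits)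
  qed
  moreover have "\<forall>p\<in>set zs. fst p \<noteq> 0 \<and> snd p \<noteq> 0"
    using xs(2) ys(2) \<sigma>(1) by (auto simp: zs_def)
  ultimately show ?thesis
    unfolding nondegenerate_def using fin xs(1) ys(1)
    by (intro conjI exI[of _ zs]) (auto simp: zs_def)
qed

lemma least_elements_subset:
  fixes C :: "nat set"
  assumes "finite C" "n \<le> card C"
  shows "\<exists>X\<subseteq>C. card X = n \<and> (\<forall>x\<in>X. \<forall>y\<in>C - X. x < y)"
  using assms(2)
proof (induction n)
  case 0
  show ?case by (intro exI[of _ "{}"]) auto
next
  case (Suc n)
  then obtain X where X: "X \<subseteq> C" "card X = n" "\<forall>x\<in>X. \<forall>y\<in>C - X. x < y"
    using Suc_leD by blast
  have ne: "C - X \<noteq> {}"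
  proof
    assume "C - X = {}"
    then have "X = C" using X(1) by blast
    then show False using X(2) Suc.prems by simp
  qed
  define y where "y = Min (C - X)"
  have y: "y \<in> C - X" using ne assms(1) unfolding y_def by (intro Min_in) auto
  have "y < z" if "z \<in> C - insert y X" for z
  proof -
    have "y \<le> z" using that assms(1) unfolding y_def by (intro Min_le) auto
    then show ?thesis using that by (cases "y = z") auto
  qed
  then have "\<forall>x\<in>insert y X. \<forall>z\<in>C - insert y X. x < z" using X(3) by blast
  moreover have "card (insert y X) = Suc n"
    using X(2) y finite_subset[OF X(1) assms(1)] by (simp add: card_insert_if)
  moreover have "insert y X \<subseteq> C" using X(1) y by blast
  ultimately show ?case by blast
qed

text \<open>
  The lowest \<open>v a\<close> points of every column \<open>a\<close> are removed. The columns that lose more points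
  than a column which is not exhausted have to lie on one side of it: then the lexicographic
  weight on the exponents realises the removal as a degeneration of one point.
\<close>

lemma nondegenerate_lex:
  fixes D :: "(nat \<times> nat) set" and v \<alpha> :: "nat \<Rightarrow> nat"
  assumes "finite D"
    and slot: "\<And>t. t \<in> {1..m} \<Longrightarrow> v (\<alpha> t) = t"
    and column: "\<And>a. v a \<noteq> 0 \<Longrightarrow> v a \<le> m \<and> \<alpha> (v a) = a"
    and height: "\<And>a. v a \<le> card (D `` {a})"
    and order: "(\<forall>a a'. v a < card (D `` {a}) \<longrightarrow> v a < v a' \<longrightarrow> a' < a) \<or>
      (\<forall>a a'. v a < card (D `` {a}) \<longrightarrow> v a < v a' \<longrightarrow> a < a')"
    and rest: "\<And>D'. finite D' \<Longrightarrow> (\<And>a. card (D' `` {a}) = card (D `` {a}) - v a) \<Longrightarrow>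
      nondegenerate TYPE('a::field_char_0) m s D'"
  shows "nondegenerate TYPE('a) m (Suc s) D"
proof -
  have finD: "finite (D `` {a})" for a using assms(1) by (rule finite_Image)
  obtain X where X: "\<And>a. X a \<subseteq> D `` {a}" "\<And>a. card (X a) = v a"
    "\<And>a x y. x \<in> X a \<Longrightarrow> y \<in> D `` {a} - X a \<Longrightarrow> x < y"
    using least_elements_subset[OF finD height] by metis
  have finX: "finite (X a)" for a by (rule finite_subset[OF X(1) finD])
  define B where "B = (\<Union>t\<in>{1..m}. {\<alpha> t} \<times> X (\<alpha> t))"
  have inj: "inj_on \<alpha> {1..m}" using slot by (metis inj_onI)
  have inB: "(a, b) \<in> B \<longleftrightarrow> b \<in> X a" for a b
  proof
    assume b: "b \<in> X a"
    then have "v a \<noteq> 0" using X(2)[of a] finX by (metis card_0_eq empty_iff)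
    then have "v a \<in> {1..m}" "\<alpha> (v a) = a" using column[of a] by auto
    then show "(a, b) \<in> B" using b by (force simp: B_def)
  qed (auto simp: B_def)
  have BD: "B \<subseteq> D" using inB X(1) by fastforce
  have cardX: "card (X (\<alpha> t)) = t" if "t \<in> {1..m}" for t using X(2) slot that by simp
  obtain L :: nat where L: "\<And>e. e \<in> D \<Longrightarrow> snd e < L"
    using assms(1) by (metis finite_imageI finite_nat_set_iff_bounded imageI)
  \<comment> \<open>Since \<open>L\<close> exceeds every height, \<open>u = L\<close> or
    \<open>u = - L\<close> compares columns first, in the direction that \<open>order\<close>
    prescribes.\<close>
  have "\<exists>u::int. \<forall>a a' b b'. v a < card (D `` {a}) \<longrightarrow> v a < v a' \<longrightarrow> b < L \<longrightarrow> b' < L \<longrightarrow>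
      u * int a' + int b' < u * int a + int b"
    using order
  proof
    assume o: "\<forall>a a'. v a < card (D `` {a}) \<longrightarrow> v a < v a' \<longrightarrow> a' < a"
    have "int L * int a' + int b' < int L * int a + int b" if "a' < a" "b' < L" for a a' b b'
    proof -
      have "L * (a' + 1) \<le> L * a" using that(1) by (intro mult_le_mono2) simp
      then have "L * a' + b' < L * a + b" using that(2) by simp
      then show ?thesis by (metis of_nat_add of_nat_less_iff of_nat_mult)
    qed
    then show ?thesis using o by blast
  next
    assume o: "\<forall>a a'. v a < card (D `` {a}) \<longrightarrow> v a < v a' \<longrightarrow> a < a'"
    have "- int L * int a' + int b' < - int L * int a + int b" if "a < a'" "b' < L" for a a' b b'
    proof -
      have "L * (a + 1) \<le> L * a'" using that(1) by (intro mult_le_mono2) simp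
      then have "L * a + b' < L * a' + b" using that(2) by simp
      then have "int L * int a + int b' < int L * int a' + int b"
        by (metis of_nat_add of_nat_less_iff of_nat_mult)
      then show ?thesis by simp
    qed
    then show ?thesis using o by blast
  qed
  then obtain u :: int where u: "\<And>a a' b b'. v a < card (D `` {a}) \<Longrightarrow> v a < v a' \<Longrightarrow>
    b < L \<Longrightarrow> b' < L \<Longrightarrow> u * int a' + int b' < u * int a + int b" by blast
  have "\<forall>b0\<in>B. \<exists>q :: nat \<times> nat \<Rightarrow> 'a. poly_fun m q \<and> (\<forall>b\<in>B. q b = (if b = b0 then 1 else 0))"
    using poly_fun_dual_basis[OF inj, of "\<lambda>t. X (\<alpha> t)"] finX cardX unfolding B_def by blast
  then obtain q :: "nat \<times> nat \<Rightarrow> nat \<times> nat \<Rightarrow> 'a" where q: "\<And>b0. b0 \<in> B \<Longrightarrow> poly_fun m (q b0)"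
    "\<And>b0 b. b0 \<in> B \<Longrightarrow> b \<in> B \<Longrightarrow> q b0 b = (if b = b0 then 1 else 0)"
    by metis
  have "nondegenerate TYPE('a) m (Suc s) (B \<union> (D - B))"
  proof (rule nondegenerate_add_point[where q = q and u = u and v = 1])
    show "finite B" by (rule finite_subset[OF BD assms(1)])
    show "nondegenerate TYPE('a) m s (D - B)"
    proof (rule rest)
      show "card ((D - B) `` {a}) = card (D `` {a}) - v a" for a
      proof -
        have "(D - B) `` {a} = D `` {a} - X a" using inB by auto
        then show ?thesis using X(1,2) finX by (simp add: card_Diff_subset)
      qed
    qed (use assms(1) in simp)
  next
    fix b e assume be: "b \<in> B" "e \<in> D - B" "q b e \<noteq> 0"
    obtain a \<beta> where e: "e = (a, \<beta>)" by (cases e)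
    have \<beta>: "\<beta> \<in> D `` {a} - X a" using be(2) inB by (auto simp: e)
    have va: "v a < card (D `` {a})"
    proof -
      have "X a \<subset> D `` {a}" using \<beta> X(1) by blast
      then show ?thesis using psubset_card_mono[OF finD] X(2) by metis
    qed
    have vm: "v a \<le> m" using column[of a] by (cases "v a = 0") auto
    show "u * int (fst b) + 1 * int (snd b) < u * int (fst e) + 1 * int (snd e)"
    proof (rule ccontr)
      assume le: "\<not> ?thesis"
      \<comment> \<open>All removed points in columns that lose more than \<open>v a\<close>, and
        those in column \<open>a\<close>, have smaller weight than \<open>e\<close>, so none of them
        is \<open>b\<close> and \<open>q b\<close> vanishes at them. These are just the zeros that
        peeling off columns requires.\<close>
      have "q b (a, \<beta>) = 0"
      proof (rule poly_fun_vanish_on_column[OF q(1)[OF be(1)] vm, where X = "\<lambda>t. X (\<alpha> t)" and Y = "X a"])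
        show "inj_on \<alpha> {v a<..m}" by (rule inj_on_subset[OF inj]) auto
        show "a \<notin> \<alpha> ` {v a<..m}"
        proof
          assume "a \<in> \<alpha> ` {v a<..m}"
          then obtain t where "t \<in> {v a<..m}" "a = \<alpha> t" by blast
          then show False using slot[of t] by auto
        qed
        show "finite (X (\<alpha> t)) \<and> card (X (\<alpha> t)) = t \<and> (\<forall>\<beta>\<in>X (\<alpha> t). q b (\<alpha> t, \<beta>) = 0)"
          if t: "t \<in> {v a<..m}" for t
        proof (intro conjI ballI)
          fix \<gamma> assume \<gamma>: "\<gamma> \<in> X (\<alpha> t)"
          have "u * int (\<alpha> t) + int \<gamma> < u * int a + int \<beta>"
            using t slot[of t] L[of "(\<alpha> t, \<gamma>)"] \<gamma> X(1) L[of e] be(2) by (intro u[OF va]) (auto simp: e)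
          then have "(\<alpha> t, \<gamma>) \<noteq> b" using le by (auto simp: e)
          then show "q b (\<alpha> t, \<gamma>) = 0" using q(2)[OF be(1)] inB \<gamma> by auto
        qed (use t finX cardX in auto)
        show "q b (a, \<gamma>) = 0" if "\<gamma> \<in> X a" for \<gamma>
        proof -
          have "(a, \<gamma>) \<noteq> b" using le X(3)[OF that \<beta>] by (auto simp: e)
          then show ?thesis using q(2)[OF be(1)] inB that by auto
        qed
      qed (use finX X(2) in auto)
      then show False using be(3) by (simp add: e)
    qed
  qed (use q in auto)
  moreover have "B \<union> (D - B) = D" using BD by blast
  ultimately show ?thesis by simp
qed

subsection \<open>Removing points column by column\<close>

text \<open>The criterion for removing points sees only column heights, so gaps and vertical shifts
  within columns are irrelevant.\<close>

definition heights_nondegenerate ::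
  "'a::field_char_0 itself \<Rightarrow> nat \<Rightarrow> nat \<Rightarrow> (nat \<Rightarrow> nat) \<Rightarrow> bool" where
  "heights_nondegenerate K m s c \<longleftrightarrow>
     (\<forall>D. finite D \<longrightarrow> (\<forall>a. card (D `` {a}) = c a) \<longrightarrow> nondegenerate K m s D)"

lemma heights_nondegenerateD:
  "heights_nondegenerate K m s c \<Longrightarrow> finite D \<Longrightarrow> (\<And>a. card (D `` {a}) = c a) \<Longrightarrow>
    nondegenerate K m s D"
  by (simp add: heights_nondegenerate_def)

lemma heights_nondegenerate_cong:
  "heights_nondegenerate K m s c \<Longrightarrow> (\<And>a. c a = c' a) \<Longrightarrow> heights_nondegenerate K m s c'"
  by (simp add: heights_nondegenerate_def)

lemma heights_nondegenerate_0: "heights_nondegenerate K m 0 (\<lambda>_. 0)"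
  unfolding heights_nondegenerate_def
proof (intro allI impI)
  fix D :: "(nat \<times> nat) set"
  assume D: "finite D" "\<forall>a. card (D `` {a}) = 0"
  have "(a, b) \<notin> D" for a b
  proof
    assume "(a, b) \<in> D"
    moreover have "finite (D `` {a})" by (rule finite_Image[OF D(1)])
    ultimately have "card (D `` {a}) \<noteq> 0" by (metis Image_singleton_iff card_0_eq empty_iff)
    then show False by (simp add: D(2))
  qed
  then have "D = {}" by (metis ex_in_conv surj_pair)
  then show "nondegenerate K m 0 D" by (simp add: nondegenerate_empty)
qed

lemma heights_nondegenerate_lex:
  assumes "\<And>t. t \<in> {1..m} \<Longrightarrow> v (\<alpha> t) = t"
    and "\<And>a. v a \<noteq> 0 \<Longrightarrow> v a \<le> m \<and> \<alpha> (v a) = a"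
    and "\<And>a. v a \<le> c a"
    and "(\<forall>a a'. v a < c a \<longrightarrow> v a < v a' \<longrightarrow> a' < a) \<or> (\<forall>a a'. v a < c a \<longrightarrow> v a < v a' \<longrightarrow> a < a')"
    and "heights_nondegenerate TYPE('a::field_char_0) m s (\<lambda>a. c a - v a)"
  shows "heights_nondegenerate TYPE('a) m (Suc s) c"
  unfolding heights_nondegenerate_def
proof (intro allI impI)
  fix D :: "(nat \<times> nat) set" assume D: "finite D" "\<forall>a. card (D `` {a}) = c a"
  show "nondegenerate TYPE('a) m (Suc s) D"
    by (rule nondegenerate_lex[where v = v and \<alpha> = \<alpha>])
      (use D assms in \<open>auto intro: heights_nondegenerateD\<close>)
qed

text \<open>The columns lose \<open>m, ..., 1\<close> points. With nothing to the left of
  \<open>l\<close>, every column that loses more than a non-exhausted one lies to its left.\<close>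

lemma heights_nondegenerate_descending:
  assumes "\<And>a. a < l \<Longrightarrow> c a = 0"
    and "\<And>a. l \<le> a \<Longrightarrow> a < l + m \<Longrightarrow> l + m \<le> c a + a"
    and "heights_nondegenerate TYPE('a::field_char_0) m s
      (\<lambda>a. if l \<le> a \<and> a < l + m then c a - (l + m - a) else c a)"
  shows "heights_nondegenerate TYPE('a) m (Suc s) c"
proof (rule heights_nondegenerate_lex
    [where v = "\<lambda>a. if l \<le> a \<and> a < l + m then l + m - a else 0" and \<alpha> = "\<lambda>t. l + m - t"])
  show "(if l \<le> a \<and> a < l + m then l + m - a else 0) \<le> c a" for a
    using assms(2)[of a] by auto
  show "(\<forall>a a'. (if l \<le> a \<and> a < l + m then l + m - a else 0) < c a \<longrightarrow>
      (if l \<le> a \<and> a < l + m then l + m - a else 0) <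
      (if l \<le> a' \<and> a' < l + m then l + m - a' else 0) \<longrightarrow> a' < a) \<or>
    (\<forall>a a'. (if l \<le> a \<and> a < l + m then l + m - a else 0) < c a \<longrightarrow>
      (if l \<le> a \<and> a < l + m then l + m - a else 0) <
      (if l \<le> a' \<and> a' < l + m then l + m - a' else 0) \<longrightarrow> a < a')"
    using assms(1) by (intro disjI1 allI impI) (force split: if_splits)
  show "heights_nondegenerate TYPE('a) m s
    (\<lambda>a. c a - (if l \<le> a \<and> a < l + m then l + m - a else 0))"
    by (rule heights_nondegenerate_cong[OF assms(3)]) auto
qed (auto split: if_splits)

text \<open>The mirror image: nothing may lie to the right of the window.\<close>

lemma heights_nondegenerate_ascending:
  assumes "\<And>a. l + m \<le> a \<Longrightarrow> c a = 0"
    and "\<And>a. l \<le> a \<Longrightarrow> a < l + m \<Longrightarrow> Suc a \<le> c a + l"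
    and "heights_nondegenerate TYPE('a::field_char_0) m s
      (\<lambda>a. if l \<le> a \<and> a < l + m then c a - (Suc a - l) else c a)"
  shows "heights_nondegenerate TYPE('a) m (Suc s) c"
proof (rule heights_nondegenerate_lex
    [where v = "\<lambda>a. if l \<le> a \<and> a < l + m then Suc a - l else 0" and \<alpha> = "\<lambda>t. l + t - 1"])
  show "(if l \<le> a \<and> a < l + m then Suc a - l else 0) \<le> c a" for a
    using assms(2)[of a] by auto
  show "(\<forall>a a'. (if l \<le> a \<and> a < l + m then Suc a - l else 0) < c a \<longrightarrow>
      (if l \<le> a \<and> a < l + m then Suc a - l else 0) <
      (if l \<le> a' \<and> a' < l + m then Suc a' - l else 0) \<longrightarrow> a' < a) \<or>
    (\<forall>a a'. (if l \<le> a \<and> a < l + m then Suc a - l else 0) < c a \<longrightarrow>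
      (if l \<le> a \<and> a < l + m then Suc a - l else 0) <
      (if l \<le> a' \<and> a' < l + m then Suc a' - l else 0) \<longrightarrow> a < a')"
    using assms(1) by (intro disjI2 allI impI) (force split: if_splits)
  show "heights_nondegenerate TYPE('a) m s
    (\<lambda>a. c a - (if l \<le> a \<and> a < l + m then Suc a - l else 0))"
    by (rule heights_nondegenerate_cong[OF assms(3)]) auto
qed (auto split: if_splits)

lemma heights_nondegenerate_triangle:
  "heights_nondegenerate TYPE('a::field_char_0) m 1
    (\<lambda>a. if l \<le> a \<and> a < l + m then l + m - a else 0)"
  unfolding One_nat_def
  by (rule heights_nondegenerate_descending[of l])
    (auto intro: heights_nondegenerate_cong[OF heights_nondegenerate_0])

definition block :: "nat \<Rightarrow> nat \<Rightarrow> nat \<Rightarrow> nat \<Rightarrow> nat" where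
  "block l w h a = (if l \<le> a \<and> a < l + w then h else 0)"

text \<open>A descending and an ascending staircase over the same \<open>m\<close> columns add up to
  \<open>m + 1\<close> points in each column.\<close>

lemma heights_nondegenerate_block:
  "heights_nondegenerate TYPE('a::field_char_0) m (2 * x) (block l m (x * (m + 1)))"
proof (induction x)
  case 0
  then show ?case
    by (simp add: heights_nondegenerate_cong[OF heights_nondegenerate_0] block_def)
next
  case (Suc x)
  have "heights_nondegenerate TYPE('a) m (Suc (Suc (2 * x))) (block l m (Suc x * (m + 1)))"
  proof (rule heights_nondegenerate_descending[of l], goal_cases)
    case 3
    show ?case
    proof (rule heights_nondegenerate_ascending[of l], goal_cases)
      case 3
      show ?case by (rule heights_nondegenerate_cong[OF Suc.IH]) (auto simp: block_def)
    qed (auto simp: block_def)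
  qed (auto simp: block_def)
  then show ?case by simp
qed

text \<open>If the ascending staircase is shifted by one column, the two cover \<open>m + 1\<close>
  columns with \<open>m\<close> points each.\<close>

lemma heights_nondegenerate_wide_block:
  "heights_nondegenerate TYPE('a::field_char_0) m (2 * y) (block l (m + 1) (y * m))"
proof (induction y)
  case 0
  then show ?case
    by (simp add: heights_nondegenerate_cong[OF heights_nondegenerate_0] block_def)
next
  case (Suc y)
  have "heights_nondegenerate TYPE('a) m (Suc (Suc (2 * y))) (block l (m + 1) (Suc y * m))"
  proof (rule heights_nondegenerate_descending[of l], goal_cases)
    case 3
    show ?case
    proof (rule heights_nondegenerate_ascending[of "Suc l"], goal_cases)
      case 3
      show ?case by (rule heights_nondegenerate_cong[OF Suc.IH]) (auto simp: block_def)
    qed (auto simp: block_def)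
  qed (auto simp: block_def)
  then show ?case by simp
qed

text \<open>
  Column \<open>l\<close> is shorter than the others: its \<open>u\<close> points are all removed, and the columns to its
  right lose \<open>m, \<dots>, 1\<close> points, the number \<open>u\<close> being skipped.
\<close>

definition skew_slot :: "nat \<Rightarrow> nat \<Rightarrow> nat \<Rightarrow> nat \<Rightarrow> nat" where
  "skew_slot l m u a =
     (if a = l then u else if l < a \<and> a + u \<le> l + m then Suc (l + m) - a
      else if l < a \<and> a \<le> l + m then l + m - a else 0)"

text \<open>Column \<open>l\<close> disturbs the descending order, but it is exhausted, so no
  condition arises from points left in it; seen from any other nonempty column it lies on the
  correct side.\<close>

lemma heights_nondegenerate_skew:
  assumes "u \<le> m" "\<And>a. a < l \<Longrightarrow> c a = 0" "c l = u"
    and "\<And>a. skew_slot l m u a \<le> c a"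
    and "heights_nondegenerate TYPE('a::field_char_0) m s (\<lambda>a. c a - skew_slot l m u a)"
  shows "heights_nondegenerate TYPE('a) m (Suc s) c"
proof (rule heights_nondegenerate_lex[where v = "skew_slot l m u" and
      \<alpha> = "\<lambda>t. if t = u then l else if u < t then Suc (l + m) - t else l + m - t"])
  show "(\<forall>a a'. skew_slot l m u a < c a \<longrightarrow> skew_slot l m u a < skew_slot l m u a' \<longrightarrow> a' < a) \<or>
    (\<forall>a a'. skew_slot l m u a < c a \<longrightarrow> skew_slot l m u a < skew_slot l m u a' \<longrightarrow> a < a')"
  proof (intro disjI1 allI impI)
    fix a a' assume a: "skew_slot l m u a < c a" "skew_slot l m u a < skew_slot l m u a'"
    have "l < a" using a(1) assms(2)[of a] assms(3) by (cases a l rule: linorder_cases)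
        (auto simp: skew_slot_def)
    then show "a' < a" using a(2) by (auto simp: skew_slot_def split: if_splits)
  qed
qed (use assms in \<open>auto simp: skew_slot_def split: if_splits\<close>)

text \<open>For \<open>y = 0\<close> a skew set and what it leaves form the pair. Each further step
  in \<open>y\<close> adds two staircases that together put \<open>m\<close> points into each of the
  \<open>m + 1\<close> columns.\<close>

lemma heights_nondegenerate_middle_narrow:
  assumes "u \<le> m" "m \<ge> 1"
  shows "heights_nondegenerate TYPE('a::field_char_0) m (2 * (y + 1))
    (\<lambda>a. if a = l then u + y * m else if l < a \<and> a < l + m then y * m + m + 1
      else if a = l + m then y * m + m + 1 - u else 0)"
proof (induction y)
  case 0
  have "heights_nondegenerate TYPE('a::field_char_0) m (Suc (Suc 0))
    (\<lambda>a. if a = l then u else if l < a \<and> a < l + m then m + 1 else if a = l + m then m + 1 - u else 0)"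
  proof (rule heights_nondegenerate_skew[of u m l], goal_cases)
    case 5
    show ?case
    \<comment> \<open>The remaining heights are \<open>1, ..., m\<close> in some order, with
      \<open>m + 1 - u\<close> in the last column. Everything is exhausted, so the order condition
      is vacuous.\<close>
    proof (rule heights_nondegenerate_lex[where
          v = "\<lambda>a. if l < a \<and> a + u \<le> l + m then a - l else if l < a \<and> a < l + m then Suc a - l
            else if a = l + m then m + 1 - u else 0" and
          \<alpha> = "\<lambda>t. if t + u \<le> m then l + t else if t + u = Suc m then l + m else l + t - 1"], goal_cases)
      case 5
      show ?case
        by (rule heights_nondegenerate_cong[OF heights_nondegenerate_0])
          (use assms in \<open>auto simp: skew_slot_def\<close>)
    qed (use assms in \<open>auto simp: skew_slot_def split: if_splits\<close>)
  qed (use assms in \<open>auto simp: skew_slot_def split: if_splits\<close>)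
  then have "heights_nondegenerate TYPE('a) m (2 * (0 + 1))
    (\<lambda>a. if a = l then u else if l < a \<and> a < l + m then m + 1 else if a = l + m then m + 1 - u else 0)"
    by (simp only: numeral_2_eq_2 mult_1_right add_0)
  then show ?case by (rule heights_nondegenerate_cong) simp
next
  case (Suc y)
  have "heights_nondegenerate TYPE('a::field_char_0) m (Suc (Suc (2 * (y + 1))))
    (\<lambda>a. if a = l then u + Suc y * m else if l < a \<and> a < l + m then Suc y * m + m + 1
      else if a = l + m then Suc y * m + m + 1 - u else 0)"
  proof (rule heights_nondegenerate_descending[of l], goal_cases)
    case 3
    show ?case
    proof (rule heights_nondegenerate_ascending[of "Suc l"], goal_cases)
      case 3
      show ?case
        by (rule heights_nondegenerate_cong[OF Suc.IH]) (use assms in auto)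
    qed (use assms in auto)
  qed (use assms in auto)
  then show ?case by simp
qed

text \<open>A skew set exhausts the short column on the left, and a mirrored one the short column of
  \<open>m - f\<close> points on the right; a block of width \<open>m\<close> is left.\<close>

lemma heights_nondegenerate_middle_wide:
  assumes "f \<le> m"
  shows "heights_nondegenerate TYPE('a::field_char_0) m (2 * (y + 1))
    (\<lambda>a. if a = l then f else if l < a \<and> a \<le> l + m then m + y * (m + 1)
      else if a = Suc (l + m) then m - f else 0)"
proof -
  define W where "W = y * (m + 1)"
  have "heights_nondegenerate TYPE('a::field_char_0) m (Suc (Suc (2 * y)))
    (\<lambda>a. if a = l then f else if l < a \<and> a \<le> l + m then m + W
      else if a = Suc (l + m) then m - f else 0)"
  proof (rule heights_nondegenerate_skew[of f m l], goal_cases)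
    case 5
    show ?case
    proof (rule heights_nondegenerate_lex[where
          v = "\<lambda>a. if l < a \<and> a + f \<le> l + m then a - l - 1 else if l < a \<and> a \<le> l + m then a - l
            else if a = Suc (l + m) then m - f else 0" and
          \<alpha> = "\<lambda>t. if t + f < m then Suc (l + t) else if t + f = m then Suc (l + m) else l + t"], goal_cases)
      case 4
      show ?case
        by (intro disjI2 allI impI) (use assms in \<open>auto simp: skew_slot_def split: if_splits\<close>)
    next
      case 5
      show ?case
        by (rule heights_nondegenerate_cong[OF heights_nondegenerate_block[of m y "Suc l"]])
          (use assms in \<open>auto simp: skew_slot_def block_def W_def\<close>)
    qed (use assms in \<open>auto simp: skew_slot_def split: if_splits\<close>)
  qed (use assms in \<open>auto simp: skew_slot_def split: if_splits\<close>)
  then have "heights_nondegenerate TYPE('a) m (2 * (y + 1))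
    (\<lambda>a. if a = l then f else if l < a \<and> a \<le> l + m then m + W
      else if a = Suc (l + m) then m - f else 0)"
    by (simp only: mult_Suc_right add_2_eq_Suc Suc_eq_plus1[symmetric])
  then show ?thesis by (rule heights_nondegenerate_cong) (simp add: W_def)
qed

subsection \<open>Cutting a triangle into strips\<close>

text \<open>
  The incomplete column \<open>l\<close> consists of its \<open>p\<close> highest points, as its lowest points are used up by
  the strip on its left.
\<close>

definition region :: "nat \<Rightarrow> nat \<Rightarrow> nat \<Rightarrow> (nat \<times> nat) set" where
  "region l n p = {(a, b). a = l \<and> Suc n \<le> b + p \<and> b \<le> n \<or> l < a \<and> a + b \<le> l + n}"

lemma finite_bounded_pairs:
  fixes D :: "(nat \<times> nat) set"
  assumes "\<And>a b. (a, b) \<in> D \<Longrightarrow> a + b \<le> n"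
  shows "finite D"
proof (rule finite_subset[of _ "{..n} \<times> {..n}"])
  show "D \<subseteq> {..n} \<times> {..n}"
  proof
    fix e assume e: "e \<in> D"
    then have "fst e + snd e \<le> n" using assms[of "fst e" "snd e"] by simp
    then show "e \<in> {..n} \<times> {..n}" by (simp add: mem_Times_iff)
  qed
qed simp

text \<open>
  The strip is cut by parallel lines into one triangle, two stacks of pairs of triangles (one
  upward, one downward) and a middle part. Along the outer stacks only one of the two incomplete
  columns on the sides of the strip is present.
\<close>

lemma nondegenerate_region_narrow:
  fixes x y z u m :: nat
  defines "p' \<equiv> x * (m + 1) + u" and "H \<equiv> (x + z + 1) * (m + 1) + y * m"
  assumes "1 \<le> m" "u \<le> m" "n' + 1 = H"
    and "nondegenerate TYPE('a::field_char_0) m s (region (l + m) n' p')"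
  shows "nondegenerate TYPE('a) m (2 * (x + y + z + 1) + 1 + s) (region l (n' + m) (p' + m * (y + 1)))"
proof -
  define X where "X = x * (m + 1)"
  define Y where "Y = y * m"
  define Z where "Z = z * (m + 1)"
  have H: "H = X + Y + Z + m + 1" by (simp add: H_def X_def Y_def Z_def algebra_simps)
  have n': "n' = X + Y + Z + m" using assms(5) H by simp
  have p': "p' = X + u" by (simp add: p'_def X_def)
  have p: "p' + m * (y + 1) = X + u + Y + m" by (simp add: p' Y_def algebra_simps)
  \<comment> \<open>The cuts are horizontal. In the rows of \<open>top\<close>, column
    \<open>l + m\<close> already belongs to the rest; in those of \<open>bot\<close>, column
    \<open>l\<close> is still empty; \<open>mid\<close> contains both transitions.\<close>
  define T where "T = {(a, b). l \<le> a \<and> H \<le> b \<and> a + b \<le> l + n' + m}"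
  define top where "top = {(a, b). l \<le> a \<and> a < l + m \<and> Y + Z + m + 1 \<le> b \<and> b < H}"
  define mid where "mid = {(a, b). l \<le> a \<and> a \<le> l + m \<and> Z \<le> b \<and> b < Y + Z + m + 1 \<and>
    (a = l \<longrightarrow> Z + m + 1 \<le> b + u) \<and> (a = l + m \<longrightarrow> b + u < Y + Z + m + 1)}"
  define bot where "bot = {(a, b). l < a \<and> a \<le> l + m \<and> b < Z}"
  have T: "nondegenerate TYPE('a) m 1 T"
  proof (rule heights_nondegenerateD[OF heights_nondegenerate_triangle[of m l]])
    show "finite T" by (rule finite_bounded_pairs[of _ "l + n' + m"]) (simp add: T_def)
    show "card (T `` {a}) = (if l \<le> a \<and> a < l + m then l + m - a else 0)" for a
    proof -
      have "T `` {a} = (if l \<le> a \<and> a < l + m then {H..<H + (l + m - a)} else {})"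
        by (auto simp: T_def H n')
      then show ?thesis by simp
    qed
  qed
  have top: "nondegenerate TYPE('a) m (2 * x) top"
  proof (rule heights_nondegenerateD[OF heights_nondegenerate_block[of m x l]])
    show "finite top" by (rule finite_bounded_pairs[of _ "l + m + H"]) (simp add: top_def)
    show "card (top `` {a}) = block l m (x * (m + 1)) a" for a
    proof -
      have "top `` {a} = (if l \<le> a \<and> a < l + m then {Y + Z + m + 1..<H} else {})"
        by (auto simp: top_def)
      then show ?thesis by (simp add: block_def H X_def)
    qed
  qed
  have mid: "nondegenerate TYPE('a) m (2 * (y + 1)) mid"
  proof (rule heights_nondegenerateD[OF heights_nondegenerate_middle_narrow[OF assms(4,3), of y l]])
    show "finite mid" by (rule finite_bounded_pairs[of _ "l + m + H"]) (simp add: mid_def H)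
    show "card (mid `` {a}) = (if a = l then u + y * m else if l < a \<and> a < l + m then y * m + m + 1
      else if a = l + m then y * m + m + 1 - u else 0)" for a
    proof -
      have "mid `` {a} = (if a = l then {Z + m + 1 - u..<Y + Z + m + 1}
        else if l < a \<and> a < l + m then {Z..<Y + Z + m + 1}
        else if a = l + m then {Z..<Y + Z + m + 1 - u} else {})"
        using assms(3,4) by (auto simp: mid_def)
      then show ?thesis using assms(4) by (simp add: Y_def)
    qed
  qed
  have bot: "nondegenerate TYPE('a) m (2 * z) bot"
  proof (rule heights_nondegenerateD[OF heights_nondegenerate_block[of m z "l + 1"]])
    show "finite bot" by (rule finite_bounded_pairs[of _ "l + m + Z"]) (simp add: bot_def)
    show "card (bot `` {a}) = block (l + 1) m (z * (m + 1)) a" for a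
    proof -
      have "bot `` {a} = (if l < a \<and> a \<le> l + m then {..<Z} else {})"
        by (auto simp: bot_def)
      then show ?thesis by (simp add: block_def Z_def Suc_le_eq)
    qed
  qed
  have "nondegenerate TYPE('a) m (1 + 2 * x) (T \<union> top)"
    by (rule nondegenerate_Un[where u = 0 and v = "- 1", OF T top]) (auto simp: T_def top_def)
  then have "nondegenerate TYPE('a) m (1 + 2 * x + 2 * (y + 1)) (T \<union> top \<union> mid)"
    by (rule nondegenerate_Un[where u = 0 and v = "- 1", OF _ mid])
      (auto simp: T_def top_def mid_def H)
  then have "nondegenerate TYPE('a) m (1 + 2 * x + 2 * (y + 1) + 2 * z) (T \<union> top \<union> mid \<union> bot)"
    by (rule nondegenerate_Un[where u = 0 and v = "- 1", OF _ bot])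
      (auto simp: T_def top_def mid_def bot_def H)
  then have "nondegenerate TYPE('a) m (1 + 2 * x + 2 * (y + 1) + 2 * z + s)
    (T \<union> top \<union> mid \<union> bot \<union> region (l + m) n' p')"
  \<comment> \<open>Lexicographic weight, column first: strip and rest share column
    \<open>l + m\<close>, where the strip owns the lower points.\<close>
  proof (rule nondegenerate_Un[where u = "int (n' + m + 1)" and v = 1, OF _ assms(6)])
    fix e e' assume e: "e \<in> T \<union> top \<union> mid \<union> bot" "e' \<in> region (l + m) n' p'"
    obtain a b a' b' where ab: "e = (a, b)" "e' = (a', b')" by (metis surj_pair)
    have bn: "b \<le> n' + m"
      using e(1) assms(4) by (auto simp: ab T_def top_def mid_def bot_def H n')
    have "a < a' \<or> a = a' \<and> b < b'"
      using e assms(3,4) by (auto simp: ab T_def top_def mid_def bot_def region_def H n' p')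
    then have "(n' + m + 1) * a + b < (n' + m + 1) * a' + b'"
    proof
      assume "a < a'"
      then have "(n' + m + 1) * (a + 1) \<le> (n' + m + 1) * a'" by (intro mult_le_mono2) simp
      then show ?thesis using bn by simp
    qed simp
    then have "int ((n' + m + 1) * a + b) < int ((n' + m + 1) * a' + b')"
      by (simp only: of_nat_less_iff)
    then show "int (n' + m + 1) * int (fst e) + 1 * int (snd e) <
        int (n' + m + 1) * int (fst e') + 1 * int (snd e')"
      by (simp only: ab fst_conv snd_conv of_nat_add of_nat_mult mult_1)
  qed
  moreover have "T \<union> top \<union> mid \<union> bot \<union> region (l + m) n' p' = region l (n' + m) (p' + m * (y + 1))"
    (is "?L = ?R")
  proof (rule set_eqI)
    fix e :: "nat \<times> nat"
    obtain a b where e: "e = (a, b)" by (metis surj_pair)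
    show "e \<in> ?L \<longleftrightarrow> e \<in> ?R"
    proof -
      consider "a < l" | "a = l" | "l < a" "a < l + m" | "a = l + m" | "l + m < a" by linarith
      then show ?thesis
        unfolding p using assms(3,4)
        by cases (auto simp: e T_def top_def mid_def bot_def region_def H n' p')
    qed
  qed
  ultimately show ?thesis by (simp add: algebra_simps)
qed

text \<open>Now the cuts are the lines of constant \<open>a + b\<close>, and the triangle lies at
  the bottom. Along \<open>bot\<close> column \<open>l\<close> is absent; along \<open>top\<close>
  column \<open>l + m + 1\<close> belongs to the rest.\<close>

lemma nondegenerate_region_wide:
  fixes x y z f m :: nat
  defines "p \<equiv> x * m + f"
  assumes "1 \<le> m" "f \<le> m" "n' + 1 = (x + z + 1) * m + y * (m + 1)"
    and "nondegenerate TYPE('a::field_char_0) m s (region (l + m + 1) n' (p + y * (m + 1)))"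
  shows "nondegenerate TYPE('a) m (2 * (x + y + z + 1) + 1 + s) (region l (n' + m + 1) p)"
proof -
  define X where "X = x * m"
  define Y where "Y = y * (m + 1)"
  define Z where "Z = z * m"
  have n': "n' + 1 = X + Y + Z + m" using assms(4) by (simp add: X_def Y_def Z_def algebra_simps)
  have p: "p = X + f" by (simp add: p_def X_def)
  define T where "T = {(a, b). l < a \<and> a + b \<le> l + m}"
  define bot where "bot = {(a, b). l < a \<and> a \<le> l + m + 1 \<and> l + m < a + b \<and> a + b \<le> l + m + Z}"
  define mid where "mid = {(a, b). l \<le> a \<and> a \<le> l + m + 1 \<and> l + m + Z < a + b \<and>
    a + b \<le> l + 2 * m + Y + Z \<and> (a = l \<longrightarrow> Z + 2 * m + Y < b + f) \<and> (a = l + m + 1 \<longrightarrow> b + f < Z + m)}"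
  define top where "top = {(a, b). l \<le> a \<and> a \<le> l + m \<and> l + 2 * m + Y + Z < a + b \<and>
    a + b \<le> l + 2 * m + X + Y + Z}"
  have T: "nondegenerate TYPE('a) m 1 T"
  proof (rule heights_nondegenerateD[OF heights_nondegenerate_triangle[of m "l + 1"]])
    show "finite T" by (rule finite_bounded_pairs[of _ "l + m"]) (simp add: T_def)
    show "card (T `` {a}) = (if l + 1 \<le> a \<and> a < l + 1 + m then l + 1 + m - a else 0)" for a
    proof -
      have "T `` {a} = (if l + 1 \<le> a \<and> a < l + 1 + m then {..<l + 1 + m - a} else {})"
        by (auto simp: T_def)
      then show ?thesis by simp
    qed
  qed
  have bot: "nondegenerate TYPE('a) m (2 * z) bot"
  proof (rule heights_nondegenerateD[OF heights_nondegenerate_wide_block[of m z "l + 1"]])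
    show "finite bot" by (rule finite_bounded_pairs[of _ "l + m + Z"]) (simp add: bot_def)
    show "card (bot `` {a}) = block (l + 1) (m + 1) (z * m) a" for a
    proof -
      have "bot `` {a} = (if l < a \<and> a \<le> l + m + 1 then {l + m + 1 - a..<l + m + 1 + Z - a} else {})"
        by (auto simp: bot_def)
      then show ?thesis by (auto simp: block_def Z_def)
    qed
  qed
  have mid: "nondegenerate TYPE('a) m (2 * (y + 1)) mid"
  proof (rule heights_nondegenerateD[OF heights_nondegenerate_middle_wide[OF assms(3), of y l]])
    show "finite mid" by (rule finite_bounded_pairs[of _ "l + 2 * m + Y + Z"]) (simp add: mid_def)
    show "card (mid `` {a}) = (if a = l then f else if l < a \<and> a \<le> l + m then m + y * (m + 1)
      else if a = Suc (l + m) then m - f else 0)" for a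
    proof -
      have "mid `` {a} = (if a = l then {Z + 2 * m + Y + 1 - f..<Z + 2 * m + Y + 1}
        else if l < a \<and> a \<le> l + m then {l + m + Z + 1 - a..<l + 2 * m + Y + Z + 1 - a}
        else if a = Suc (l + m) then {Z..<Z + m - f} else {})"
        using assms(3) by (auto simp: mid_def)
      then show ?thesis using assms(3) by (auto simp: Y_def)
    qed
  qed
  have top: "nondegenerate TYPE('a) m (2 * x) top"
  proof (rule heights_nondegenerateD[OF heights_nondegenerate_wide_block[of m x l]])
    show "finite top"
      by (rule finite_bounded_pairs[of _ "l + 2 * m + X + Y + Z"]) (simp add: top_def)
    show "card (top `` {a}) = block l (m + 1) (x * m) a" for a
    proof -
      have "top `` {a} = (if l \<le> a \<and> a \<le> l + m
        then {l + 2 * m + Y + Z + 1 - a..<l + 2 * m + X + Y + Z + 1 - a} else {})"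
        by (auto simp: top_def)
      then show ?thesis by (auto simp: block_def X_def)
    qed
  qed
  have "nondegenerate TYPE('a) m (1 + 2 * z) (T \<union> bot)"
    by (rule nondegenerate_Un[where u = 1 and v = 1, OF T bot]) (auto simp: T_def bot_def)
  then have "nondegenerate TYPE('a) m (1 + 2 * z + 2 * (y + 1)) (T \<union> bot \<union> mid)"
    by (rule nondegenerate_Un[where u = 1 and v = 1, OF _ mid])
      (auto simp: T_def bot_def mid_def)
  then have "nondegenerate TYPE('a) m (1 + 2 * z + 2 * (y + 1) + 2 * x) (T \<union> bot \<union> mid \<union> top)"
    by (rule nondegenerate_Un[where u = 1 and v = 1, OF _ top])
      (auto simp: T_def bot_def mid_def top_def)
  then have "nondegenerate TYPE('a) m (1 + 2 * z + 2 * (y + 1) + 2 * x + s)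
    (T \<union> bot \<union> mid \<union> top \<union> region (l + m + 1) n' (p + y * (m + 1)))"
  proof (rule nondegenerate_Un[where u = "int (n' + m + 2)" and v = 1, OF _ assms(5)])
    fix e e' assume e: "e \<in> T \<union> bot \<union> mid \<union> top" "e' \<in> region (l + m + 1) n' (p + y * (m + 1))"
    obtain a b a' b' where ab: "e = (a, b)" "e' = (a', b')" by (metis surj_pair)
    have bn: "b \<le> n' + m + 1"
      using e(1) assms(3) n' by (auto simp: ab T_def top_def mid_def bot_def)
    have "a < a' \<or> a = a' \<and> b < b'"
      using e assms(2,3) n' unfolding Y_def[symmetric]
      by (auto simp: ab T_def top_def mid_def bot_def region_def p)
    then have "(n' + m + 2) * a + b < (n' + m + 2) * a' + b'"
    proof
      assume "a < a'"
      then have "(n' + m + 2) * (a + 1) \<le> (n' + m + 2) * a'" by (intro mult_le_mono2) simp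
      then show ?thesis using bn by simp
    qed simp
    then have "int ((n' + m + 2) * a + b) < int ((n' + m + 2) * a' + b')"
      by (simp only: of_nat_less_iff)
    then show "int (n' + m + 2) * int (fst e) + 1 * int (snd e) <
        int (n' + m + 2) * int (fst e') + 1 * int (snd e')"
      by (simp only: ab fst_conv snd_conv of_nat_add of_nat_mult mult_1)
  qed
  moreover have "T \<union> bot \<union> mid \<union> top \<union> region (l + m + 1) n' (p + y * (m + 1)) = region l (n' + m + 1) p"
    (is "?L = ?R")
  proof (rule set_eqI)
    fix e :: "nat \<times> nat"
    obtain a b where e: "e = (a, b)" by (metis surj_pair)
    show "e \<in> ?L \<longleftrightarrow> e \<in> ?R"
    proof -
      consider "a < l" | "a = l" | "l < a" "a \<le> l + m" | "a = l + m + 1" | "l + m + 1 < a" by linarith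
      then show ?thesis
        unfolding Y_def[symmetric] using assms(2,3) n'
        by cases (auto simp: e T_def top_def mid_def bot_def region_def p)
    qed
  qed
  ultimately show ?thesis by (simp add: algebra_simps)
qed

section \<open>Arithmetic of the side length and of the incomplete column\<close>

lemma triangular_decomposition: "\<exists>n p :: nat. p \<le> n \<and> n * (n + 1) + 2 * p = 2 * N"
proof (induction N)
  case (Suc N)
  then obtain n p where np: "p \<le> n" "n * (n + 1) + 2 * p = 2 * N" by blast
  show ?case
  proof (cases "p = n")
    case True
    then show ?thesis using np by (intro exI[of _ "n + 1"] exI[of _ 0]) auto
  next
    case False
    then show ?thesis using np by (intro exI[of _ n] exI[of _ "p + 1"]) auto
  qed
qed auto

text \<open>If \<open>n < k m\<close>, the total stays below \<open>(n + 1) (n + 2)\<close>, hence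
  below \<open>k m (k m + 1)\<close>, which is at most \<open>k^2 m (m + 1)\<close> because
  \<open>k \<le> k^2\<close>.\<close>

lemma triangle_side_ge:
  fixes n p k m :: nat
  assumes "p \<le> n" "n * (n + 1) + 2 * p = k\<^sup>2 * (m * (m + 1))" "1 \<le> k"
  shows "k * m \<le> n"
proof (rule ccontr)
  assume "\<not> ?thesis"
  then have "n + 1 \<le> k * m" by simp
  then have "(n + 1) * (n + 2) \<le> k * m * (k * m + 1)" by (intro mult_le_mono) auto
  moreover have "k * m * (k * m + 1) \<le> k\<^sup>2 * (m * (m + 1))"
    using assms(3) by (simp add: power2_eq_square algebra_simps)
  moreover have "n * (n + 1) + 2 * p < (n + 1) * (n + 2)" using assms(1) by simp
  ultimately show False using assms(2) by linarith
qed

text \<open>Compare squares: \<open>(2 n + 1)^2\<close> is at most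
  \<open>(2 k m + k)^2 - k^2 + 1\<close>. For \<open>k = 1\<close> and \<open>n = m\<close> the two
  sides agree, hence the bound on \<open>k\<close>.\<close>

lemma triangle_side_less:
  fixes n p k m :: nat
  assumes "n * (n + 1) + 2 * p = k\<^sup>2 * (m * (m + 1))" "2 \<le> k"
  shows "2 * n + 1 < 2 * k * m + k"
proof (rule ccontr)
  assume "\<not> ?thesis"
  then have "(2 * k * m + k)\<^sup>2 \<le> (2 * n + 1)\<^sup>2" by (intro power_mono) auto
  moreover have "(2 * k * m + k)\<^sup>2 = 4 * (k\<^sup>2 * (m * (m + 1))) + k\<^sup>2"
    by (simp add: power2_eq_square algebra_simps)
  moreover have "(2 * n + 1)\<^sup>2 = 4 * (n * (n + 1)) + 1"
    by (simp add: power2_eq_square algebra_simps)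
  moreover have "2\<^sup>2 \<le> k\<^sup>2" using assms(2) by (intro power_mono) auto
  ultimately show False using assms(1) by (simp add: power2_eq_square)
qed

text \<open>
  The exact side length of the triangle for \<open>k\<close> grows by almost \<open>m + 1/2\<close> when \<open>k\<close> grows by 1; its
  integral part therefore grows by \<open>m\<close> or \<open>m + 1\<close>, which gives the two kinds of strips.
\<close>

lemma nondegenerate_region:
  assumes "1 \<le> k" "1 \<le> m" "p \<le> n" "n * (n + 1) + 2 * p = k\<^sup>2 * (m * (m + 1))"
  shows "nondegenerate TYPE('a::field_char_0) m (k\<^sup>2) (region l n p)"
  using assms(1,3,4)
proof (induction k arbitrary: l n p rule: nat_induct_at_least)
  case base
  have "m \<le> n" using triangle_side_ge[OF base(1,2)] by simp
  moreover have "n < m + 1"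
  proof (rule ccontr)
    assume "\<not> n < m + 1"
    then have "(m + 1) * (m + 2) \<le> n * (n + 1)" by (intro mult_le_mono) auto
    then show False using base(2) assms(2) by simp
  qed
  ultimately have "n = m" by simp
  then have nm: "n = m" "p = 0" using base(2) by auto
  show ?case
  proof (rule heights_nondegenerateD)
    show "heights_nondegenerate TYPE('a) m (1\<^sup>2)
        (\<lambda>a. if l + 1 \<le> a \<and> a < l + 1 + m then l + 1 + m - a else 0)"
      using heights_nondegenerate_triangle[of m "l + 1"] by simp
    show "finite (region l n p)"
      by (rule finite_bounded_pairs[of _ "l + n"]) (auto simp: region_def)
    show "card (region l n p `` {a}) = (if l + 1 \<le> a \<and> a < l + 1 + m then l + 1 + m - a else 0)" for a
    proof -
      have "region l n p `` {a} = (if l + 1 \<le> a \<and> a < l + 1 + m then {..<l + 1 + m - a} else {})"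
        by (auto simp: region_def nm)
      then show ?thesis by simp
    qed
  qed
next
  case (Suc k)
  note k = \<open>1 \<le> k\<close>
  have "even (k\<^sup>2 * (m * (m + 1)))" by simp
  then obtain N where "k\<^sup>2 * (m * (m + 1)) = 2 * N" by blast
  then obtain n' p' where np': "p' \<le> n'" "n' * (n' + 1) + 2 * p' = k\<^sup>2 * (m * (m + 1))"
    using triangular_decomposition[of N] by auto
  \<comment> \<open>The excesses \<open>i\<close> and \<open>j\<close> over the sides
    \<open>(k + 1) m\<close> and \<open>k m\<close> decide the width of the strip: it is
    \<open>m + i - j\<close>.\<close>
  obtain i where i: "n = Suc k * m + i" using triangle_side_ge[OF Suc.prems] le_Suc_ex by auto
  obtain j where j: "n' = k * m + j" using triangle_side_ge[OF np' k] le_Suc_ex by auto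
  have ik: "2 * i < k" using triangle_side_less[OF Suc.prems(2)] k by (simp add: i algebra_simps)
  have jk: "2 * j < k"
  proof (cases "k = 1")
    case True
    have "n' < m + 1"
    proof (rule ccontr)
      assume "\<not> n' < m + 1"
      then have "(m + 1) * (m + 2) \<le> n' * (n' + 1)" by (intro mult_le_mono) auto
      then show False using np'(2) True assms(2) by simp
    qed
    then show ?thesis using True j by simp
  next
    case False
    then have "2 * n' + 1 < 2 * k * m + k" using triangle_side_less[OF np'(2)] k by simp
    then show ?thesis by (simp add: j algebra_simps)
  qed
  define P Q A :: int where "P = int p" and "Q = int p'" and "A = int k * int m"
  have P: "2 * P + 2 * (A + int m) * int i + int i * int i + int i = A * (int k + 1)"
  proof -
    have "int (n * (n + 1) + 2 * p) = int ((Suc k)\<^sup>2 * (m * (m + 1)))" using Suc.prems(2) by simp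
    then show ?thesis by (simp add: P_def A_def i power2_eq_square algebra_simps)
  qed
  have Q: "2 * Q + 2 * A * int j + int j * int j + int j = A * (int k - 1)"
  proof -
    have "int (n' * (n' + 1) + 2 * p') = int (k\<^sup>2 * (m * (m + 1)))" using np'(2) by simp
    then show ?thesis by (simp add: Q_def A_def j power2_eq_square algebra_simps)
  qed
  have bounds: "0 \<le> P" "P \<le> A + int m + int i" "0 \<le> Q" "Q \<le> A + int j"
    using Suc.prems(1) np'(1) by (auto simp: P_def Q_def A_def i j algebra_simps simp flip: of_nat_mult)
  have A0: "0 \<le> A" by (simp add: A_def)
  \<comment> \<open>The difference of the equations \<open>P\<close> and \<open>Q\<close> limits the
    jump: \<open>j > i\<close> would force \<open>p > n\<close>, and \<open>i > j + 1\<close> would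
    force \<open>p' > n'\<close>.\<close>
  have "j \<le> i"
  proof (rule ccontr)
    assume "\<not> j \<le> i"
    then obtain d where d: "j = i + 1 + d" using less_imp_Suc_add by fastforce
    then have d': "int j = int i + 1 + int d" by simp
    have "0 \<le> 2 * A * int d" "0 \<le> int d * int i" "0 \<le> int d * int d" using A0 by simp_all
    then have "2 * A \<le> 2 * int m * int i + 2 * int m"
      using P Q bounds unfolding d' by (simp only: algebra_simps)
    then have "int k * int m \<le> (int i + 1) * int m" by (simp add: A_def algebra_simps)
    then have "int k \<le> int i + 1" using assms(2) by simp
    then show False using ik jk d by linarith
  qed
  have "i \<le> j + 1"
  proof (rule ccontr)
    assume "\<not> i \<le> j + 1"
    then have "j + 2 \<le> i" by simp
    then obtain d where d: "i = j + 2 + d" using le_Suc_ex by blast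
    then have d': "int i = int j + 2 + int d" by simp
    have "0 \<le> 2 * A * int d" "0 \<le> int d * int j" "0 \<le> int d * int d" "0 \<le> int m * int d"
      "0 \<le> int m * int j" using A0 by simp_all
    then have "4 * int m \<le> 0"
      using P Q bounds A0 unfolding d' by (simp only: algebra_simps)
    then show False using assms(2) by simp
  qed
  then consider "i = j" | "i = j + 1" using \<open>j \<le> i\<close> by linarith
  then show ?case
  proof cases
    case 1
    have kk: "k = i + (k - 1 - i) + 1" using ik by simp
    \<comment> \<open>The increment must be \<open>m (y + 1)\<close>, so
      \<open>y = k - 1 - i\<close>. The count \<open>2 k + 1\<close> of pieces then forces
      \<open>x + z = i\<close>, and \<open>x\<close> is a quotient by \<open>m + 1\<close>.\<close>
    have "P = Q + int m * (int k - int i)"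
      using P Q unfolding 1 A_def by (simp add: algebra_simps)
    then have "int p = int (p' + m * (k - i))" using ik by (simp add: P_def Q_def of_nat_diff)
    then have p: "p = p' + m * (k - i)" by (simp only: of_nat_eq_iff)
    \<comment> \<open>The bound \<open>p \<le> n\<close> is what makes \<open>x \<le> i\<close>, so
      that \<open>z = i - x\<close> is meaningful.\<close>
    have "p' + m * (k - i) \<le> k * m + m + i" using Suc.prems(1) p i by simp
    moreover have "m * (k - i) + i * m = k * m"
    proof -
      have "m * (k - i) + i * m = m * (k - i + i)" by (simp only: distrib_left mult.commute[of i m])
      then show ?thesis using ik by (simp add: mult.commute)
    qed
    ultimately have p'_less: "p' < (i + 1) * (m + 1)" by simp
    define x u where "x = p' div (m + 1)" and "u = p' mod (m + 1)"
    have "p' = x * (m + 1) + u" by (simp only: x_def u_def div_mult_mod_eq)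
    moreover have "u \<le> m" by (simp add: u_def flip: less_Suc_eq_le)
    moreover have "x \<le> i"
      using less_mult_imp_div_less[OF p'_less] by (simp add: x_def)
    ultimately have xu: "p' = x * (m + 1) + u" "u \<le> m" "x \<le> i" .
    have "nondegenerate TYPE('a) m (2 * (x + (k - 1 - i) + (i - x) + 1) + 1 + k\<^sup>2)
      (region l (n' + m) (x * (m + 1) + u + m * ((k - 1 - i) + 1)))"
    proof (rule nondegenerate_region_narrow)
      show "n' + 1 = (x + (i - x) + 1) * (m + 1) + (k - 1 - i) * m"
      proof -
        have "k * m = i * m + (k - 1 - i) * m + m"
          by (subst kk) (simp only: distrib_right mult_1)
        then show ?thesis using xu(3) by (simp add: j 1[symmetric])
      qed
      show "nondegenerate TYPE('a) m (k\<^sup>2) (region (l + m) n' (x * (m + 1) + u))"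
        using Suc.IH[OF np'] xu(1) by simp
    qed (use assms(2) xu in auto)
    moreover have "2 * (x + (k - 1 - i) + (i - x) + 1) + 1 + k\<^sup>2 = (Suc k)\<^sup>2"
      using xu(3) ik by (simp add: power2_eq_square)
    moreover have "n' + m = n" by (simp add: i j 1)
    moreover have "x * (m + 1) + u + m * ((k - 1 - i) + 1) = p"
    proof -
      have "k - 1 - i + 1 = k - i" using ik by simp
      then show ?thesis using p xu(1) by (simp only:)
    qed
    ultimately show ?thesis by simp
  next
    case 2
    \<comment> \<open>Here the incomplete column grows towards the smaller region, by
      \<open>y (m + 1)\<close> with \<open>y = i\<close>; \<open>x\<close> is a quotient by
      \<open>m\<close>, and \<open>x + z = k - 1 - i\<close>.\<close>
    have "Q = P + int i * (int m + 1)"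
      using P Q unfolding 2 A_def by (simp add: algebra_simps)
    then have "int p' = int (p + i * (m + 1))" by (simp add: P_def Q_def algebra_simps)
    then have p': "p' = p + i * (m + 1)" by (simp only: of_nat_eq_iff)
    have km: "(k - i) * m + i * m = k * m" using ik by (simp flip: distrib_right)
    have p_less: "p < (k - i) * m" using np'(1) p' j 2 km by simp
    define x f where "x = p div m" and "f = p mod m"
    have xf: "p = x * m + f" "f \<le> m" "x < k - i"
      using p_less less_mult_imp_div_less[of p "k - i" m] assms(2)
      by (auto simp: x_def f_def less_imp_le)
    have "nondegenerate TYPE('a) m (2 * (x + i + (k - i - x - 1) + 1) + 1 + k\<^sup>2)
      (region l (n' + m + 1) (x * m + f))"
    proof (rule nondegenerate_region_wide)
      show "n' + 1 = (x + (k - i - x - 1) + 1) * m + i * (m + 1)"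
      proof -
        have "x + (k - i - x - 1) + 1 = k - i" using xf(3) by simp
        then have "(x + (k - i - x - 1) + 1) * m + i * (m + 1) = (k - i) * m + i * m + i"
          by (simp only: distrib_left mult_1_right add.assoc)
        then show ?thesis unfolding km using 2 j by simp
      qed
      show "nondegenerate TYPE('a) m (k\<^sup>2) (region (l + m + 1) n' (x * m + f + i * (m + 1)))"
        using Suc.IH[OF np'] xf(1) p' by simp
    qed (use assms(2) xf in auto)
    moreover have "2 * (x + i + (k - i - x - 1) + 1) + 1 + k\<^sup>2 = (Suc k)\<^sup>2"
      using xf(3) ik by (simp add: power2_eq_square)
    moreover have "n' + m + 1 = n" by (simp add: i j 2)
    ultimately show ?thesis using xf(1) by simp
  qed
qed

subsection \<open>Vanishing order of forms\<close>

lemma lookup_mult_single: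
  fixes f :: "('k::cancel_comm_monoid_add) \<Rightarrow>\<^sub>0 'b::semiring_0"
  shows "Poly_Mapping.lookup (Poly_Mapping.single 0 c * f) k = c * Poly_Mapping.lookup f k"
proof -
  have "Poly_Mapping.single 0 c * f = Poly_Mapping.map ((*) c) f"
    by (rule mult_map_scale_conv_mult[symmetric])
  then show ?thesis by (simp add: Poly_Mapping.map.rep_eq when_def)
qed

lemma lookup_mpoly_scale: "Poly_Mapping.lookup (mpoly_scale c f) e = c * Poly_Mapping.lookup f e"
  by (simp add: mpoly_scale_def lookup_mult_single)

lemma mpoly_sum_single:
  fixes f :: "'k \<Rightarrow>\<^sub>0 'b::comm_monoid_add"
  assumes "finite A" "Poly_Mapping.keys f \<subseteq> A"
  shows "f = (\<Sum>e\<in>A. Poly_Mapping.single e (Poly_Mapping.lookup f e))"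
proof (rule poly_mapping_eqI)
  fix k
  have "Poly_Mapping.lookup (\<Sum>e\<in>A. Poly_Mapping.single e (Poly_Mapping.lookup f e)) k =
      (\<Sum>e\<in>A. if e = k then Poly_Mapping.lookup f e else 0)"
    by (simp add: lookup_sum lookup_single when_def)
  also have "\<dots> = Poly_Mapping.lookup f k"
    using assms by (auto simp: in_keys_iff)
  finally show "Poly_Mapping.lookup f k =
    Poly_Mapping.lookup (\<Sum>e\<in>A. Poly_Mapping.single e (Poly_Mapping.lookup f e)) k" by simp
qed

lemma mpoly_induct [case_names single add]:
  fixes f :: "'k \<Rightarrow>\<^sub>0 'b::comm_monoid_add"
  assumes "\<And>e c. Q (Poly_Mapping.single e c)" "\<And>f g. Q f \<Longrightarrow> Q g \<Longrightarrow> Q (f + g)"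
  shows "Q f"
proof -
  have "Q (\<Sum>e\<in>A. Poly_Mapping.single e (Poly_Mapping.lookup f e))" if "finite A" for A
    using that
  proof (induction A rule: finite_induct)
    case empty
    show ?case using assms(1)[of undefined 0] by simp
  qed (simp add: assms)
  then have "Q (\<Sum>e\<in>Poly_Mapping.keys f. Poly_Mapping.single e (Poly_Mapping.lookup f e))" by simp
  then show ?thesis by (simp flip: mpoly_sum_single)
qed

definition monomial_value :: "('v \<Rightarrow> 'a::comm_ring_1) \<Rightarrow> ('v \<Rightarrow>\<^sub>0 nat) \<Rightarrow> 'a" where
  "monomial_value c e = (\<Prod>v\<in>Poly_Mapping.keys e. c v ^ Poly_Mapping.lookup e v)"

lemma monomial_value_superset:
  "finite A \<Longrightarrow> Poly_Mapping.keys e \<subseteq> A \<Longrightarrow> monomial_value c e = (\<Prod>v\<in>A. c v ^ Poly_Mapping.lookup e v)"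
  unfolding monomial_value_def by (intro prod.mono_neutral_left) (auto simp: in_keys_iff)

lemma monomial_value_0 [simp]: "monomial_value c 0 = 1"
  by (simp add: monomial_value_def)

lemma monomial_value_add: "monomial_value c (d + e) = monomial_value c d * monomial_value c e"
proof -
  define A where "A = Poly_Mapping.keys d \<union> Poly_Mapping.keys e"
  have A: "finite A" "Poly_Mapping.keys d \<subseteq> A" "Poly_Mapping.keys e \<subseteq> A" "Poly_Mapping.keys (d + e) \<subseteq> A"
    using keys_add[of d e] by (auto simp: A_def)
  show ?thesis
    by (simp add: monomial_value_superset[OF A(1)] A lookup_add power_add prod.distrib)
qed

lemma mpoly_eval_superset:
  assumes "finite A" "Poly_Mapping.keys f \<subseteq> A"
  shows "mpoly_eval c f = (\<Sum>e\<in>A. Poly_Mapping.lookup f e * monomial_value c e)"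
  unfolding mpoly_eval_def monomial_value_def
  using assms by (intro sum.mono_neutral_left) (auto simp: in_keys_iff)

lemma mpoly_eval_single [simp]: "mpoly_eval c (Poly_Mapping.single e a) = a * monomial_value c e"
  by (simp add: mpoly_eval_superset[of "{e}"])

lemma mpoly_eval_0 [simp]: "mpoly_eval c 0 = 0"
  by (simp add: mpoly_eval_def)

lemma mpoly_eval_1 [simp]: "mpoly_eval c 1 = 1"
  using mpoly_eval_single[of c 0 1] by simp

lemma mpoly_eval_add [simp]: "mpoly_eval c (f + g) = mpoly_eval c f + mpoly_eval c g"
proof -
  define A where "A = Poly_Mapping.keys f \<union> Poly_Mapping.keys g"
  have A: "finite A" "Poly_Mapping.keys f \<subseteq> A" "Poly_Mapping.keys g \<subseteq> A" "Poly_Mapping.keys (f + g) \<subseteq> A"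
    using keys_add[of f g] by (auto simp: A_def)
  show ?thesis
    by (simp add: mpoly_eval_superset[OF A(1)] A lookup_add distrib_right sum.distrib)
qed

lemma mpoly_eval_mult [simp]: "mpoly_eval c (f * g) = mpoly_eval c f * mpoly_eval c g"
proof (induction f rule: mpoly_induct)
  case (single e a)
  show ?case
    by (induction g rule: mpoly_induct)
      (simp_all add: mult_single monomial_value_add distrib_left distrib_right ac_simps)
qed (simp add: distrib_right)

lemma mpoly_eval_diff [simp]: "mpoly_eval c (f - g) = mpoly_eval c f - mpoly_eval c g"
  using mpoly_eval_add[of c "f - g" g] by (simp add: algebra_simps)

lemma is_ring_hom_mpoly_eval: "is_ring_hom (mpoly_eval c)"
  by (simp add: is_ring_hom_def)

lemma cases_3: "v = 0 \<or> v = 1 \<or> v = 2" for v :: 3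
proof (induction v)
  case (of_int z)
  then have "z = 0 \<or> z = 1 \<or> z = 2" by fastforce
  then show ?case by auto
qed

lemma UNIV_3: "(UNIV :: 3 set) = {0, 1, 2}"
  using cases_3 by auto

text \<open>Homogenisation of an affine exponent. Because of truncated subtraction it has degree
  \<open>d\<close> only for \<open>a + b \<le> d\<close>.\<close>

definition exponent :: "nat \<Rightarrow> nat \<times> nat \<Rightarrow> 3 \<Rightarrow>\<^sub>0 nat" where
  "exponent d = (\<lambda>(a, b). Poly_Mapping.single 0 (d - a - b) + Poly_Mapping.single 1 a + Poly_Mapping.single 2 b)"

text \<open>The derivation \<open>x_v d/dx_v\<close>: diagonal on monomials and degree preserving,
  so it can be iterated on forms.\<close>

definition euler :: "'v \<Rightarrow> ('v, 'a::comm_ring_1) mpoly \<Rightarrow> ('v, 'a) mpoly" where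
  "euler v f = Poly_Mapping.mapp (\<lambda>e c. of_nat (Poly_Mapping.lookup e v) * c) f"

lemma lookup_euler:
  "Poly_Mapping.lookup (euler v f) e = of_nat (Poly_Mapping.lookup e v) * Poly_Mapping.lookup f e"
  by (simp add: euler_def lookup_mapp when_def in_keys_iff)

lemma euler_add: "euler v (f + g) = euler v f + euler v g"
  by (rule poly_mapping_eqI) (simp add: lookup_euler lookup_add distrib_left)

lemma euler_single: "euler v (Poly_Mapping.single e c) = Poly_Mapping.single e (of_nat (Poly_Mapping.lookup e v) * c)"
  by (rule poly_mapping_eqI) (simp add: lookup_euler lookup_single when_def)

lemma euler_mult: "euler v (f * g) = euler v f * g + f * euler v g"
proof (induction f rule: mpoly_induct)
  case (single e a)
  show ?case
  proof (induction g rule: mpoly_induct)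
    case (single e' b)
    show ?case
      by (simp add: mult_single euler_single lookup_add distrib_right distrib_left ac_simps
          flip: single_add)
  qed (simp add: euler_add distrib_left)
qed (simp add: euler_add distrib_right)

text \<open>At points with a zero coordinate this is weaker than vanishing to order
  \<open>m\<close>; it is meant as an upper bound for powers of point ideals.\<close>

primrec vanishing_order_ge :: "('v \<Rightarrow> 'a::comm_ring_1) \<Rightarrow> nat \<Rightarrow> ('v, 'a) mpoly set" where
  "vanishing_order_ge c 0 = UNIV"
| "vanishing_order_ge c (Suc m) =
     {f. mpoly_eval c f = 0 \<and> (\<forall>v. euler v f \<in> vanishing_order_ge c m)}"

lemma euler_0 [simp]: "euler v 0 = 0"
  by (rule poly_mapping_eqI) (simp add: lookup_euler)

lemma vanishing_order_ge_0 [simp]: "0 \<in> vanishing_order_ge c m"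
  by (induction m) auto

lemma vanishing_order_ge_add:
  "f \<in> vanishing_order_ge c m \<Longrightarrow> g \<in> vanishing_order_ge c m \<Longrightarrow> f + g \<in> vanishing_order_ge c m"
  by (induction m arbitrary: f g) (auto simp: euler_add)

lemma vanishing_order_ge_Suc: "f \<in> vanishing_order_ge c (Suc m) \<Longrightarrow> f \<in> vanishing_order_ge c m"
  by (induction m arbitrary: f) auto

lemma vanishing_order_ge_mult:
  "f \<in> vanishing_order_ge c m \<Longrightarrow> g * f \<in> vanishing_order_ge c m"
proof (induction m arbitrary: f g)
  case (Suc m)
  have "euler v (g * f) \<in> vanishing_order_ge c m" for v
    unfolding euler_mult using Suc.IH Suc.prems vanishing_order_ge_Suc[OF Suc.prems]
    by (intro vanishing_order_ge_add) auto
  then show ?case using Suc.prems by simp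
qed simp

text \<open>By the Leibniz rule a derivative falls either on \<open>g\<close>, leaving
  \<open>f\<close> intact, or on \<open>f\<close>, which costs one order that the induction
  hypothesis restores.\<close>

lemma vanishing_order_ge_mult_Suc:
  "mpoly_eval c g = 0 \<Longrightarrow> f \<in> vanishing_order_ge c m \<Longrightarrow> g * f \<in> vanishing_order_ge c (Suc m)"
proof (induction m arbitrary: f)
  case 0
  then show ?case by simp
next
  case (Suc m)
  have "euler v (g * f) \<in> vanishing_order_ge c (Suc m)" for v
  proof -
    have "g * euler v f \<in> vanishing_order_ge c (Suc m)"
      using Suc.prems by (intro Suc.IH) auto
    then show ?thesis
      unfolding euler_mult by (intro vanishing_order_ge_add vanishing_order_ge_mult[OF Suc.prems(2)])
  qed
  then show ?case using Suc.prems by simp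
qed

text \<open>Such a \<open>g\<close> is a unit near the point. In
  \<open>g * euler v f = euler v (g * f) - euler v g * f\<close> the last term is harmless, as
  \<open>f\<close> has order \<open>m\<close> by induction.\<close>

lemma vanishing_order_ge_cancel:
  fixes c :: "'v \<Rightarrow> 'a::field"
  assumes "mpoly_eval c g \<noteq> 0" "g * f \<in> vanishing_order_ge c m"
  shows "f \<in> vanishing_order_ge c m"
  using assms(2)
proof (induction m arbitrary: f)
  case (Suc m)
  have f: "f \<in> vanishing_order_ge c m" by (rule Suc.IH[OF vanishing_order_ge_Suc[OF Suc.prems]])
  have "euler v f \<in> vanishing_order_ge c m" for v
  proof (rule Suc.IH)
    have "euler v (g * f) + (- euler v g) * f \<in> vanishing_order_ge c m"
      using Suc.prems by (intro vanishing_order_ge_add vanishing_order_ge_mult[OF f]) auto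
    then show "g * euler v f \<in> vanishing_order_ge c m" by (simp add: euler_mult)
  qed
  then show ?case using Suc.prems assms(1) by simp
qed simp

section \<open>Ideals and their powers\<close>

lemma ideal_generated_minimal:
  assumes "S \<subseteq> J" "0 \<in> J" "\<And>f g. f \<in> J \<Longrightarrow> g \<in> J \<Longrightarrow> f + g \<in> J" "\<And>f g. f \<in> J \<Longrightarrow> g * f \<in> J"
  shows "ideal_generated S \<subseteq> J"
  unfolding ideal_generated_def
  by (rule module.span_minimal[OF module_times assms(1)])
    (auto simp: module.subspace_def[OF module_times] assms(2-4))

lemma ideal_generated_add:
  "f \<in> ideal_generated S \<Longrightarrow> g \<in> ideal_generated S \<Longrightarrow> f + g \<in> ideal_generated S"
  unfolding ideal_generated_def by (rule module.span_add[OF module_times])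

lemma ideal_generated_mult: "f \<in> ideal_generated S \<Longrightarrow> g * f \<in> ideal_generated S"
  unfolding ideal_generated_def by (rule module.span_scale[OF module_times])

lemma ideal_generated_0: "0 \<in> ideal_generated S"
  unfolding ideal_generated_def by (rule module.span_zero[OF module_times])

lemma ideal_generated_base: "f \<in> S \<Longrightarrow> f \<in> ideal_generated S"
  unfolding ideal_generated_def by (rule module.span_base[OF module_times])

lemma ideal_power_vanishing:
  "ideal_power (point_ideal p) m \<subseteq> vanishing_order_ge p m"
proof (induction m)
  case (Suc m)
  have "point_ideal p \<subseteq> {f. mpoly_eval p f = 0}"
    unfolding point_ideal_def by (rule ideal_generated_minimal) auto
  then have "{a * b |a b. a \<in> point_ideal p \<and> b \<in> ideal_power (point_ideal p) m}
      \<subseteq> vanishing_order_ge p (Suc m)"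
    using Suc vanishing_order_ge_mult_Suc[of p] by (blast)
  then show ?case
    unfolding ideal_power.simps
    by (rule ideal_generated_minimal)
      (auto intro: vanishing_order_ge_add vanishing_order_ge_mult simp del: vanishing_order_ge.simps)
qed simp

lemma ideal_power_add:
  "f \<in> ideal_power I m \<Longrightarrow> g \<in> ideal_power I m \<Longrightarrow> f + g \<in> ideal_power I m"
  by (cases m) (auto intro: ideal_generated_add)

lemma ideal_power_mult: "f \<in> ideal_power I m \<Longrightarrow> g * f \<in> ideal_power I m"
  by (cases m) (auto intro: ideal_generated_mult)

lemma ideal_power_0: "0 \<in> ideal_power I m"
  by (cases m) (auto intro: ideal_generated_0)

lemma ideal_power_sum: "(\<And>i. i \<in> A \<Longrightarrow> f i \<in> ideal_power I m) \<Longrightarrow> sum f A \<in> ideal_power I m"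
  by (induction A rule: infinite_finite_induct) (auto intro: ideal_power_add ideal_power_0)

lemma ideal_power_Suc_mult: "f \<in> I \<Longrightarrow> g \<in> ideal_power I m \<Longrightarrow> f * g \<in> ideal_power I (Suc m)"
  unfolding ideal_power.simps by (rule ideal_generated_base) auto

lemma ideal_power_decreasing: "n \<le> m \<Longrightarrow> ideal_power I m \<subseteq> ideal_power I n"
proof (induction n arbitrary: m)
  case (Suc n)
  then obtain m' where m': "m = Suc m'" "n \<le> m'" by (cases m) auto
  have "{a * b |a b. a \<in> I \<and> b \<in> ideal_power I m'} \<subseteq> ideal_power I (Suc n)"
    using Suc.IH[OF m'(2)] by (auto simp del: ideal_power.simps intro: ideal_power_Suc_mult)
  then show ?case
    unfolding m'(1) ideal_power.simps(2)[of I m']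
    by (rule ideal_generated_minimal)
      (auto simp del: ideal_power.simps intro: ideal_power_add ideal_power_mult ideal_power_0)
qed simp

lemma power_mult_in_ideal_power: "f \<in> I \<Longrightarrow> g \<in> I \<Longrightarrow> f ^ a * g ^ b \<in> ideal_power I (a + b)"
proof (induction a)
  case 0
  then show ?case
    by (induction b) (auto intro: ideal_power_Suc_mult simp del: ideal_power.simps(2))
next
  case (Suc a)
  then show ?case
    using ideal_power_Suc_mult[of f I "f ^ a * g ^ b" "a + b"] by (simp add: mult.assoc del: ideal_power.simps)
qed

subsection \<open>Forms through fat points\<close>

lemma monomial_value_single [simp]: "monomial_value c (Poly_Mapping.single v n) = c v ^ n"
  by (simp add: monomial_value_def)

text \<open>The matrix entries are polynomials in the coordinates of the points. The special points
  show that the witness of openness is a nonzero polynomial, and one with coefficients in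
  \<open>F\<close> cannot vanish at algebraically independent coordinates.\<close>

lemma generic_interpolates:
  fixes F :: "'a::field_char_0 set"
  assumes "is_subfield F" "generic_points F r P" "nondegenerate TYPE('a) m r D"
  shows "interpolates m ((\<lambda>i. (P i 1 / P i 0, P i 2 / P i 0)) ` {..<r}) D"
proof -
  obtain xs :: "('a \<times> 'a) list" where xs: "length xs = r" "interpolates m (set xs) D"
    using assms(3) by (auto simp: nondegenerate_def)
  have finD: "finite D" using assms(3) by (simp add: nondegenerate_def)
  define J where "J = {..<r} \<times> {(u :: nat, v :: nat). u + v < m}"
  define l :: "nat \<times> nat \<times> nat \<Rightarrow> nat \<times> nat \<Rightarrow> (nat \<times> 3, 'a) mpoly" where
    "l = (\<lambda>(i, u, v) (a, b). Poly_Mapping.single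
      (Poly_Mapping.single (i, 1) a + Poly_Mapping.single (i, 2) b) (of_nat a ^ u * of_nat b ^ v))"
  have eval_l: "mpoly_eval c (l (i, j) e) = jet_coeff ((c (i, 1), c (i, 2)), j) e"
    for c :: "nat \<times> 3 \<Rightarrow> 'a" and i j e
    by (simp add: l_def jet_coeff_def monomial_value_add split: prod.split)
  have interpolates_iff: "interpolates m ((\<lambda>i. (c (i, 1), c (i, 2))) ` {..<r}) D \<longleftrightarrow>
      kernel_trivial (\<lambda>i e. mpoly_eval c (l i e)) J D" for c :: "nat \<times> 3 \<Rightarrow> 'a"
  proof -
    have "(\<lambda>i. (c (i, 1), c (i, 2))) ` {..<r} \<times> {(u, v). u + v < m} =
        (\<lambda>(i, j). ((c (i, 1), c (i, 2)), j)) ` J"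
      by (auto simp: J_def image_iff)
    then show ?thesis
      by (simp add: interpolates_def kernel_trivial_def J_def eval_l split_def)
  qed
  define I where "I = {..<r} \<times> {1, 2 :: 3}"
  \<comment> \<open>The subring in which the witness has to lie for algebraic independence over
    \<open>F\<close> to apply.\<close>
  define S where "S = {f :: (nat \<times> 3, 'a) mpoly.
    (\<forall>e. Poly_Mapping.lookup f e \<in> F) \<and> (\<forall>e\<in>Poly_Mapping.keys f. Poly_Mapping.keys e \<subseteq> I)}"
  have F: "1 \<in> F" "\<And>x y. x \<in> F \<Longrightarrow> y \<in> F \<Longrightarrow> x - y \<in> F" "\<And>x y. x \<in> F \<Longrightarrow> y \<in> F \<Longrightarrow> x * y \<in> F"
    using assms(1) by (auto simp: is_subfield_def)
  have F0: "0 \<in> F" using F(2)[OF F(1) F(1)] by simp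
  have Fadd: "x + y \<in> F" if "x \<in> F" "y \<in> F" for x y
    using F(2)[OF that(1) F(2)[OF F0 that(2)]] by simp
  have Fnat: "of_nat n \<in> F" for n by (induction n) (auto intro: F0 F(1) Fadd)
  have Fpow: "x ^ n \<in> F" if "x \<in> F" for x n by (induction n) (auto intro: F(1,3) that)
  have S_single: "Poly_Mapping.single e c \<in> S" if "c \<in> F" "Poly_Mapping.keys e \<subseteq> I" for e c
    using that F0 by (auto simp: S_def lookup_single when_def split: if_splits)
  have S_diff: "f - g \<in> S" if "f \<in> S" "g \<in> S" for f g
  proof -
    have "e \<in> Poly_Mapping.keys f \<or> e \<in> Poly_Mapping.keys g" if "e \<in> Poly_Mapping.keys (f - g)" for e
      using that by (auto simp: in_keys_iff lookup_minus)
    then show ?thesis using that F(2) unfolding S_def lookup_minus mem_Collect_eq by blast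
  qed
  have S_0: "0 \<in> S" using F0 by (simp add: S_def)
  have S_add: "f + g \<in> S" if "f \<in> S" "g \<in> S" for f g
    using S_diff[OF that(1) S_diff[OF S_0 that(2)]] by simp
  have S_sum: "sum h A \<in> S" if "\<And>e. e \<in> A \<Longrightarrow> h e \<in> S" for h :: "'b \<Rightarrow> _" and A
    using that by (induction A rule: infinite_finite_induct) (auto intro: S_0 S_add)
  have S_mult: "f * g \<in> S" if fg: "f \<in> S" "g \<in> S" for f g
  proof -
    have "f * g = (\<Sum>e\<in>Poly_Mapping.keys f. Poly_Mapping.single e (Poly_Mapping.lookup f e)) *
        (\<Sum>e\<in>Poly_Mapping.keys g. Poly_Mapping.single e (Poly_Mapping.lookup g e))"
      by (simp flip: mpoly_sum_single)
    also have "\<dots> = (\<Sum>e\<in>Poly_Mapping.keys f. \<Sum>e'\<in>Poly_Mapping.keys g.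
        Poly_Mapping.single (e + e') (Poly_Mapping.lookup f e * Poly_Mapping.lookup g e'))"
      by (simp add: sum_product mult_single)
    also have "\<dots> \<in> S"
    proof (intro S_sum S_single F(3))
      fix e e' assume "e \<in> Poly_Mapping.keys f" "e' \<in> Poly_Mapping.keys g"
      then have "Poly_Mapping.keys e \<subseteq> I" "Poly_Mapping.keys e' \<subseteq> I" using fg by (simp_all add: S_def)
      then show "Poly_Mapping.keys (e + e') \<subseteq> I" using keys_add[of e e'] by blast
    qed (use fg in \<open>simp_all add: S_def\<close>)
    finally show ?thesis .
  qed
  have "l j e \<in> S" if "j \<in> J" for j e
  proof -
    obtain i u v a b where "j = (i, u, v)" "e = (a, b)" by (metis surj_pair)
    moreover have "i < r" using that calculation by (auto simp: J_def)
    then have "Poly_Mapping.keys (Poly_Mapping.single (i, 1 :: 3) a + Poly_Mapping.single (i, 2) b) \<subseteq> I"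
      using keys_add[of "Poly_Mapping.single (i, 1 :: 3) a" "Poly_Mapping.single (i, 2) b"]
      by (auto simp: I_def split: if_splits)
    ultimately show ?thesis by (auto simp: l_def intro!: S_single F(3) Fpow Fnat)
  qed
  moreover define c0 where "c0 = (\<lambda>(i, j). if j = (1 :: 3) then fst (xs ! i) else snd (xs ! i))"
  have "(\<lambda>i. (c0 (i, 1), c0 (i, 2))) ` {..<r} = set xs"
    by (auto simp: c0_def set_conv_nth xs(1) image_iff)
  then have "kernel_trivial (\<lambda>i e. mpoly_eval c0 (l i e)) J D"
    using xs(2) interpolates_iff[of c0] by simp
  moreover have "1 \<in> S" using S_single[of 1 0] F(1) by simp
  ultimately have "\<exists>\<delta>\<in>S. mpoly_eval c0 \<delta> \<noteq> 0 \<and> (\<forall>\<psi> :: (nat \<times> 3, 'a) mpoly \<Rightarrow> 'a. is_ring_hom \<psi> \<longrightarrow>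
      \<psi> \<delta> \<noteq> 0 \<longrightarrow> kernel_trivial (\<lambda>i e. \<psi> (l i e)) J D)"
    by (intro kernel_trivial_open[OF finD is_ring_hom_mpoly_eval] S_diff S_mult)
  then obtain \<delta> where \<delta>: "\<delta> \<in> S" "mpoly_eval c0 \<delta> \<noteq> 0"
    "\<And>c :: nat \<times> 3 \<Rightarrow> 'a. mpoly_eval c \<delta> \<noteq> 0 \<Longrightarrow> kernel_trivial (\<lambda>i e. mpoly_eval c (l i e)) J D"
    using is_ring_hom_mpoly_eval by metis
  have "mpoly_eval (\<lambda>(i, j). P i j / P i 0) \<delta> \<noteq> 0"
    using assms(2) \<delta>(1,2) unfolding generic_points_def algebraically_independent_def S_def I_def
    by fastforce
  then show ?thesis
    using \<delta>(3)[of "\<lambda>(i, j). P i j / P i 0"] interpolates_iff[of "\<lambda>(i, j). P i j / P i 0"] by simp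
qed

section \<open>Exponents of forms and dehomogenisation\<close>

abbreviation triangle :: "nat \<Rightarrow> (nat \<times> nat) set" where
  "triangle n \<equiv> {(a, b). a + b < n}"

lemma finite_triangle [simp]: "finite (triangle n)"
  by (rule finite_bounded_pairs[of _ n]) auto

lemma card_triangle: "card (triangle n) = n * (n + 1) div 2"
proof (induction n)
  case (Suc n)
  have "triangle (Suc n) = triangle n \<union> (\<lambda>a. (a, n - a)) ` {..n}"
    by (auto simp: image_iff)
  moreover have "triangle n \<inter> (\<lambda>a. (a, n - a)) ` {..n} = {}" by auto
  moreover have "card ((\<lambda>a. (a, n - a)) ` {..n}) = Suc n"
    by (subst card_image) (auto simp: inj_on_def)
  ultimately have "card (triangle (Suc n)) = n * (n + 1) div 2 + Suc n"
    using Suc by (simp add: card_Un_disjoint)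
  then show ?case by simp
qed simp

lemma card_region:
  assumes "p \<le> n"
  shows "card (region 0 n p) = n * (n + 1) div 2 + p"
proof -
  have "region 0 n p = (\<lambda>b. (0, b)) ` {Suc n - p..n} \<union> (\<lambda>(a, b). (Suc a, b)) ` triangle n"
    using assms by (auto simp: region_def image_iff gr0_conv_Suc)
  moreover have "(\<lambda>b. (0, b)) ` {Suc n - p..n} \<inter> (\<lambda>(a, b). (Suc a, b)) ` triangle n = {}"
    by auto
  moreover have "card ((\<lambda>b. (0 :: nat, b)) ` {Suc n - p..n}) = p"
    using assms by (subst card_image) (auto simp: inj_on_def)
  moreover have "card ((\<lambda>(a, b). (Suc a, b)) ` triangle n) = n * (n + 1) div 2"
    by (subst card_image) (auto simp: inj_on_def card_triangle[simplified])
  ultimately show ?thesis by (simp add: card_Un_disjoint)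
qed

lemma lookup_exponent:
  "Poly_Mapping.lookup (exponent d (a, b)) 0 = d - a - b"
  "Poly_Mapping.lookup (exponent d (a, b)) 1 = a"
  "Poly_Mapping.lookup (exponent d (a, b)) 2 = b"
  by (simp_all add: exponent_def lookup_add lookup_single)

lemma lookup_exponent_fst: "Poly_Mapping.lookup (exponent d e) 1 = fst e"
  and lookup_exponent_snd: "Poly_Mapping.lookup (exponent d e) 2 = snd e"
  by (cases e; simp add: lookup_exponent)+

lemma inj_exponent: "inj (exponent d)"
  by (rule injI) (metis lookup_exponent(2,3) surj_pair)

lemma sum_3: "(\<Sum>v\<in>(UNIV :: 3 set). f v) = f 0 + f 1 + f 2"
  unfolding UNIV_3 by (simp add: ac_simps)

lemma homogeneous_keys:
  assumes "homogeneous d f"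
  shows "Poly_Mapping.keys f \<subseteq> exponent d ` triangle (Suc d)"
proof
  fix e assume "e \<in> Poly_Mapping.keys f"
  then have "(\<Sum>v\<in>UNIV. Poly_Mapping.lookup e v) = d"
    using assms unfolding homogeneous_def by blast
  then have s: "Poly_Mapping.lookup e 0 + Poly_Mapping.lookup e 1 + Poly_Mapping.lookup e 2 = d"
    by (simp add: sum_3)
  have "e = exponent d (Poly_Mapping.lookup e 1, Poly_Mapping.lookup e 2)"
  proof (rule poly_mapping_eqI)
    fix v :: 3
    show "Poly_Mapping.lookup e v =
      Poly_Mapping.lookup (exponent d (Poly_Mapping.lookup e 1, Poly_Mapping.lookup e 2)) v"
      using cases_3[of v] s by (auto simp: lookup_exponent)
  qed
  then show "e \<in> exponent d ` triangle (Suc d)" using s by force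
qed

lemma homogeneous_sum_exponent:
  assumes "A \<subseteq> triangle (Suc d)"
  shows "homogeneous d (\<Sum>e\<in>A. Poly_Mapping.single (exponent d e) (f e))"
  unfolding homogeneous_def
proof
  fix k assume "k \<in> Poly_Mapping.keys (\<Sum>e\<in>A. Poly_Mapping.single (exponent d e) (f e))"
  then obtain e where e: "e \<in> A" "k \<in> Poly_Mapping.keys (Poly_Mapping.single (exponent d e) (f e))"
    using keys_sum[of "\<lambda>e. Poly_Mapping.single (exponent d e) (f e)" A] by blast
  then have "k = exponent d e" by (simp split: if_splits)
  then obtain a b where "(a, b) \<in> A" "k = exponent d (a, b)" using e(1) by (cases e) auto
  then show "(\<Sum>v\<in>UNIV. Poly_Mapping.lookup k v) = d"
    using assms by (auto simp: sum_3 lookup_exponent)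
qed

lemma lookup_sum_exponent:
  assumes "finite A"
  shows "Poly_Mapping.lookup (\<Sum>e\<in>A. Poly_Mapping.single (exponent d e) (f e)) (exponent d e) =
    (if e \<in> A then f e else 0)"
proof -
  have "exponent d e' = exponent d e \<longleftrightarrow> e' = e" for e' by (rule inj_eq[OF inj_exponent])
  then show ?thesis using assms by (simp add: lookup_sum lookup_single when_def)
qed

lemma mpoly_eval_homogeneous:
  fixes p :: "3 \<Rightarrow> 'a::field"
  assumes "homogeneous d f" "p 0 \<noteq> 0"
  shows "mpoly_eval p f = p 0 ^ d * (\<Sum>e\<in>triangle (Suc d).
    (p 1 / p 0) ^ fst e * (p 2 / p 0) ^ snd e * Poly_Mapping.lookup f (exponent d e))"
proof -
  have "mpoly_eval p f = (\<Sum>k\<in>exponent d ` triangle (Suc d). Poly_Mapping.lookup f k * monomial_value p k)"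
    by (rule mpoly_eval_superset) (use homogeneous_keys[OF assms(1)] in auto)
  also have "\<dots> = (\<Sum>e\<in>triangle (Suc d). Poly_Mapping.lookup f (exponent d e) * monomial_value p (exponent d e))"
    using inj_on_subset[OF inj_exponent] by (subst sum.reindex) auto
  also have "\<dots> = (\<Sum>e\<in>triangle (Suc d). p 0 ^ d * ((p 1 / p 0) ^ fst e * (p 2 / p 0) ^ snd e * Poly_Mapping.lookup f (exponent d e)))"
  proof (rule sum.cong)
    fix e assume "e \<in> triangle (Suc d)"
    then obtain a b where e: "e = (a, b)" "a + b \<le> d" by auto
    have "p 0 ^ d = p 0 ^ (d - a - b) * p 0 ^ a * p 0 ^ b"
      using e(2) by (simp flip: power_add)
    then have "monomial_value p (exponent d e) = p 0 ^ d * ((p 1 / p 0) ^ a * (p 2 / p 0) ^ b)"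
      using assms(2) by (simp add: e(1) exponent_def monomial_value_add power_divide)
    then show "Poly_Mapping.lookup f (exponent d e) * monomial_value p (exponent d e) =
      p 0 ^ d * ((p 1 / p 0) ^ fst e * (p 2 / p 0) ^ snd e * Poly_Mapping.lookup f (exponent d e))"
      by (simp add: e(1))
  qed simp
  finally show ?thesis by (simp add: sum_distrib_left)
qed

lemma homogeneous_euler: "homogeneous d f \<Longrightarrow> homogeneous d (euler v f)"
  unfolding homogeneous_def by (auto simp: in_keys_iff lookup_euler)

text \<open>Applying \<open>euler 1\<close> \<open>u\<close> times and \<open>euler 2\<close>
  \<open>v\<close> times multiplies the coefficient at \<open>(a, b)\<close> by
  \<open>a^u b^v\<close>; evaluating at \<open>p\<close> gives the jet condition up to the factor
  \<open>p 0 ^ d\<close>.\<close>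

lemma vanishing_order_jets:
  fixes p :: "3 \<Rightarrow> 'a::field"
  assumes "p 0 \<noteq> 0" "homogeneous d f" "f \<in> vanishing_order_ge p m" "u + v < m"
  shows "(\<Sum>e\<in>triangle (Suc d). jet_coeff ((p 1 / p 0, p 2 / p 0), u, v) e *
    Poly_Mapping.lookup f (exponent d e)) = 0"
proof -
  have "(\<Sum>e\<in>triangle (Suc d). of_nat (fst e) ^ u * of_nat (snd e) ^ v *
      ((p 1 / p 0) ^ fst e * (p 2 / p 0) ^ snd e * Poly_Mapping.lookup f (exponent d e))) = 0"
    using assms(2-4)
  proof (induction u arbitrary: m f)
    case 0
    then show ?case
    proof (induction v arbitrary: m f)
      case 0
      then have "mpoly_eval p f = 0" by (cases m) auto
      then show ?case using mpoly_eval_homogeneous[of d f p] 0 assms(1) by simp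
    next
      case (Suc v)
      then obtain m' where "m = Suc m'" by (cases m) auto
      then have "(\<Sum>e\<in>triangle (Suc d). of_nat (fst e) ^ 0 * of_nat (snd e) ^ v *
        ((p 1 / p 0) ^ fst e * (p 2 / p 0) ^ snd e * Poly_Mapping.lookup (euler 2 f) (exponent d e))) = 0"
        using Suc.prems by (intro Suc.IH[of _ m']) (auto intro: homogeneous_euler)
      then show ?case 
        by (simp add: lookup_euler lookup_exponent_fst lookup_exponent_snd ac_simps)
    qed
  next
    case (Suc u)
    then obtain m' where "m = Suc m'" by (cases m) auto
    then have "(\<Sum>e\<in>triangle (Suc d). of_nat (fst e) ^ u * of_nat (snd e) ^ v *
      ((p 1 / p 0) ^ fst e * (p 2 / p 0) ^ snd e * Poly_Mapping.lookup (euler 1 f) (exponent d e))) = 0"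
      using Suc.prems by (intro Suc.IH[of _ m']) (auto intro: homogeneous_euler)
    then show ?case 
        by (simp add: lookup_euler lookup_exponent_fst lookup_exponent_snd ac_simps)
  qed
  then show ?thesis by (simp add: jet_coeff_def case_prod_beta mult.assoc)
qed

abbreviation scalar :: "'a::comm_ring_1 \<Rightarrow> ('v, 'a) mpoly" where
  "scalar \<equiv> Poly_Mapping.single 0"

lemma sum_scalar: "(\<Sum>i\<in>A. scalar (f i)) = scalar (sum f A)"
  by (induction A rule: infinite_finite_induct) (simp_all add: single_add)

text \<open>
  Modulo the \<open>m\<close>-th power of the ideal of a point, forms of degree \<open>d\<close> are spanned by the
  \<open>m (m + 1) / 2\<close> forms \<open>x\<^sub>0\<^bsup>d-\<alpha>-\<beta>\<^esup> l\<^sub>1\<^bsup>\<alpha>\<^esup> l\<^sub>2\<^bsup>\<beta>\<^esup>\<close> with \<open>\<alpha> + \<beta> < m\<close>, where \<open>l\<^sub>1\<close> and \<open>l\<^sub>2\<close> are linear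
  forms vanishing at the point.
\<close>

lemma monomials_mod_ideal_power:
  fixes p :: "3 \<Rightarrow> 'a::field"
  assumes "p 0 \<noteq> 0"
  shows "\<exists>c B. \<forall>e\<in>triangle (Suc d). Poly_Mapping.single (exponent d e) 1 -
    (\<Sum>j\<in>triangle m. scalar (c j e) * B j) \<in> ideal_power (point_ideal p) m"
proof -
  define X :: "3 \<Rightarrow> (3, 'a) mpoly" where "X v = Poly_Mapping.single (Poly_Mapping.single v 1) 1" for v
  define q where "q v = p v / p 0" for v
  define l where "l v = X v - scalar (q v) * X 0" for v
  define B where "B = (\<lambda>(\<alpha>, \<beta>). l 1 ^ \<alpha> * l 2 ^ \<beta> * X 0 ^ (d - \<alpha> - \<beta>))"
  \<comment> \<open>Coefficients of the expansion of
    \<open>(l 1 + q 1 X 0)^a (l 2 + q 2 X 0)^b\<close>. The powers of \<open>X 0\<close> add up to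
    \<open>d - \<alpha> - \<beta>\<close>, so \<open>B\<close> does not depend on the
    monomial.\<close>
  define c where "c = (\<lambda>(\<alpha>, \<beta>) (a, b). of_nat (a choose \<alpha>) * q 1 ^ (a - \<alpha>) * (of_nat (b choose \<beta>) * q 2 ^ (b - \<beta>)))"
  have X_power: "X v ^ n = Poly_Mapping.single (Poly_Mapping.single v n) 1" for v n
    by (induction n) (simp_all add: X_def mult_single flip: single_add)
  have scalar_power: "scalar x ^ n = scalar (x ^ n)" for x :: 'a and n
    by (induction n) (simp_all add: mult_single)
  have hom: "homogeneous 1 (l v)" for v
  proof -
    have "homogeneous 1 (X v)" for v
      by (simp add: homogeneous_def X_def sum_3 lookup_single when_def) (use cases_3[of v] in blast)
    moreover have "scalar (q v) * X 0 = Poly_Mapping.single (Poly_Mapping.single 0 1) (q v)"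
      by (simp add: X_def mult_single)
    then have "homogeneous 1 (scalar (q v) * X 0)"
      by (auto simp: homogeneous_def sum_3 lookup_single)
    ultimately show ?thesis
      unfolding homogeneous_def l_def by (auto simp: in_keys_iff lookup_minus)
  qed
  have l: "l v \<in> point_ideal p" for v
    unfolding point_ideal_def using assms hom
    by (intro ideal_generated_base) (auto simp: l_def X_def q_def)
  have expand: "X v ^ a = (\<Sum>\<alpha>\<le>a. scalar (of_nat (a choose \<alpha>) * q v ^ (a - \<alpha>)) * (l v ^ \<alpha> * X 0 ^ (a - \<alpha>)))"
    for v a
  proof -
    have "X v ^ a = (l v + scalar (q v) * X 0) ^ a" by (simp add: l_def)
    also have "\<dots> = (\<Sum>\<alpha>\<le>a. of_nat (a choose \<alpha>) * l v ^ \<alpha> * (scalar (q v) * X 0) ^ (a - \<alpha>))"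
      by (rule binomial_ring)
    also have "\<dots> = (\<Sum>\<alpha>\<le>a. scalar (of_nat (a choose \<alpha>) * q v ^ (a - \<alpha>)) * (l v ^ \<alpha> * X 0 ^ (a - \<alpha>)))"
    proof (rule sum.cong)
      fix \<alpha>
      have "scalar (of_nat (a choose \<alpha>) * q v ^ (a - \<alpha>)) =
          (of_nat (a choose \<alpha>) * scalar (q v) ^ (a - \<alpha>) :: (3, 'a) mpoly)"
        by (simp add: scalar_power mult_single flip: single_of_nat)
      then show "of_nat (a choose \<alpha>) * l v ^ \<alpha> * (scalar (q v) * X 0) ^ (a - \<alpha>) =
          scalar (of_nat (a choose \<alpha>) * q v ^ (a - \<alpha>)) * (l v ^ \<alpha> * X 0 ^ (a - \<alpha>))"
        by (simp add: power_mult_distrib ac_simps)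
    qed simp
    finally show ?thesis .
  qed
  have "Poly_Mapping.single (exponent d e) 1 - (\<Sum>j\<in>triangle m. scalar (c j e) * B j)
      \<in> ideal_power (point_ideal p) m" if e_tri: "e \<in> triangle (Suc d)" for e
  proof -
    obtain a b where e: "e = (a, b)" "a + b \<le> d" using e_tri by auto
    have "Poly_Mapping.single (exponent d e) 1 = X 0 ^ (d - a - b) * (X 1 ^ a * X 2 ^ b)"
      by (simp add: e(1) X_power mult_single exponent_def add.assoc)
    also have "X 1 ^ a * X 2 ^ b = (\<Sum>\<alpha>\<le>a. \<Sum>\<beta>\<le>b.
        scalar (of_nat (a choose \<alpha>) * q 1 ^ (a - \<alpha>)) * (l 1 ^ \<alpha> * X 0 ^ (a - \<alpha>)) *
        (scalar (of_nat (b choose \<beta>) * q 2 ^ (b - \<beta>)) * (l 2 ^ \<beta> * X 0 ^ (b - \<beta>))))"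
      by (simp only: expand[of 1 a] expand[of 2 b] sum_product)
    also have "X 0 ^ (d - a - b) * \<dots> = (\<Sum>\<alpha>\<le>a. \<Sum>\<beta>\<le>b. scalar (c (\<alpha>, \<beta>) e) * B (\<alpha>, \<beta>))"
      unfolding sum_distrib_left
    proof (intro sum.cong refl)
      fix \<alpha> \<beta> assume ab: "\<alpha> \<in> {..a}" "\<beta> \<in> {..b}"
      have "d - \<alpha> - \<beta> = (d - a - b) + ((a - \<alpha>) + (b - \<beta>))" using ab e(2) by simp
      then have X0: "X 0 ^ (d - \<alpha> - \<beta>) = X 0 ^ (d - a - b) * (X 0 ^ (a - \<alpha>) * X 0 ^ (b - \<beta>))"
        by (simp only: power_add)
      have "scalar (c (\<alpha>, \<beta>) e) = scalar (of_nat (a choose \<alpha>) * q 1 ^ (a - \<alpha>)) *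
          (scalar (of_nat (b choose \<beta>) * q 2 ^ (b - \<beta>)) :: (3, 'a) mpoly)"
        by (simp add: c_def e(1) mult_single)
      then show "X 0 ^ (d - a - b) * (scalar (of_nat (a choose \<alpha>) * q 1 ^ (a - \<alpha>)) * (l 1 ^ \<alpha> * X 0 ^ (a - \<alpha>)) *
        (scalar (of_nat (b choose \<beta>) * q 2 ^ (b - \<beta>)) * (l 2 ^ \<beta> * X 0 ^ (b - \<beta>)))) =
        scalar (c (\<alpha>, \<beta>) e) * B (\<alpha>, \<beta>)"
        by (simp only: B_def prod.case X0 ac_simps)
    qed
    also have "\<dots> = (\<Sum>j\<in>{..a} \<times> {..b}. scalar (c j e) * B j)"
      by (simp add: sum.cartesian_product split_def)
    finally have eq: "Poly_Mapping.single (exponent d e) 1 = (\<Sum>j\<in>{..a} \<times> {..b}. scalar (c j e) * B j)" .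
    have "(\<Sum>j\<in>triangle m. scalar (c j e) * B j) = (\<Sum>j\<in>triangle m \<inter> {..a} \<times> {..b}. scalar (c j e) * B j)"
    proof (rule sum.mono_neutral_right)
      have "c (\<alpha>, \<beta>) e = 0" if "\<not> (\<alpha> \<le> a \<and> \<beta> \<le> b)" for \<alpha> \<beta>
        using that by (auto simp: c_def e(1) binomial_eq_0 not_le)
      then have "c j e = 0" if "j \<notin> {..a} \<times> {..b}" for j
        using that by (cases j) auto
      then show "\<forall>j\<in>triangle m - triangle m \<inter> {..a} \<times> {..b}. scalar (c j e) * B j = 0"
        by simp
    qed auto
    moreover have "(\<Sum>j\<in>{..a} \<times> {..b}. scalar (c j e) * B j) =
        (\<Sum>j\<in>{..a} \<times> {..b} - triangle m. scalar (c j e) * B j) +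
        (\<Sum>j\<in>triangle m \<inter> {..a} \<times> {..b}. scalar (c j e) * B j)"
      by (subst sum.union_disjoint[symmetric]) (auto intro: sum.cong)
    ultimately have "Poly_Mapping.single (exponent d e) 1 - (\<Sum>j\<in>triangle m. scalar (c j e) * B j) =
        (\<Sum>j\<in>{..a} \<times> {..b} - triangle m. scalar (c j e) * B j)"
      using eq by simp
    also have "\<dots> \<in> ideal_power (point_ideal p) m"
    proof (intro ideal_power_sum ideal_power_mult)
      fix j assume "j \<in> {..a} \<times> {..b} - triangle m"
      then obtain \<alpha> \<beta> where j: "j = (\<alpha>, \<beta>)" "m \<le> \<alpha> + \<beta>" by (cases j) auto
      have "l 1 ^ \<alpha> * l 2 ^ \<beta> \<in> ideal_power (point_ideal p) m"
        using power_mult_in_ideal_power[OF l l] ideal_power_decreasing[OF j(2)] by blast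
      then have "X 0 ^ (d - \<alpha> - \<beta>) * (l 1 ^ \<alpha> * l 2 ^ \<beta>) \<in> ideal_power (point_ideal p) m"
        by (rule ideal_power_mult)
      then show "B j \<in> ideal_power (point_ideal p) m"
        by (simp only: B_def j(1) prod.case mult.commute)
    qed
    finally show ?thesis .
  qed
  then show ?thesis by blast
qed

text \<open>Modulo the power of its ideal, each point imposes \<open>card (triangle m)\<close>
  linear conditions on the coefficients; with more exponents than conditions a nonzero solution
  exists.\<close>

lemma exists_fat_points_form:
  fixes P :: "nat \<Rightarrow> 3 \<Rightarrow> 'a::field"
  assumes "\<And>i. i < r \<Longrightarrow> P i 0 \<noteq> 0" "A \<subseteq> triangle (Suc d)" "r * card (triangle m) < card A"
  shows "\<exists>f. (\<exists>e\<in>A. f e \<noteq> 0) \<and>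
    (\<Sum>e\<in>A. Poly_Mapping.single (exponent d e) (f e)) \<in> fat_points_ideal r m P"
proof -
  have "\<forall>i\<in>{..<r}. \<exists>c B. \<forall>e\<in>triangle (Suc d). Poly_Mapping.single (exponent d e) 1 -
    (\<Sum>j\<in>triangle m. scalar (c j e) * B j) \<in> ideal_power (point_ideal (P i)) m"
    using monomials_mod_ideal_power assms(1) by blast
  from bchoice[OF this] obtain c where "\<forall>i\<in>{..<r}. \<exists>B. \<forall>e\<in>triangle (Suc d).
    Poly_Mapping.single (exponent d e) 1 - (\<Sum>j\<in>triangle m. scalar (c i j e) * B j)
      \<in> ideal_power (point_ideal (P i)) m" ..
  from bchoice[OF this] obtain B where cB: "\<And>i e. i < r \<Longrightarrow> e \<in> triangle (Suc d) \<Longrightarrow> Poly_Mapping.single (exponent d e) 1 -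
    (\<Sum>j\<in>triangle m. scalar (c i j e) * B i j) \<in> ideal_power (point_ideal (P i)) m"
    unfolding Ball_def lessThan_iff by blast
  have finA: "finite A" using assms(2) by (rule finite_subset) simp
  have "\<not> kernel_trivial (\<lambda>(i, j). c i j) ({..<r} \<times> triangle m) A"
    using kernel_trivial_card_le[OF finA, of "{..<r} \<times> triangle m"] assms(3)
    by (auto simp: card_cartesian_product simp del: split_paired_All)
  then obtain f where f: "\<And>i j. i < r \<Longrightarrow> j \<in> triangle m \<Longrightarrow> (\<Sum>e\<in>A. c i j e * f e) = 0" "\<exists>e\<in>A. f e \<noteq> 0"
    unfolding kernel_trivial_def by auto
  have "(\<Sum>e\<in>A. Poly_Mapping.single (exponent d e) (f e)) \<in> ideal_power (point_ideal (P i)) m" if i: "i < r" for i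
  proof -
    have "(\<Sum>e\<in>A. scalar (f e) * (\<Sum>j\<in>triangle m. scalar (c i j e) * B i j)) =
        (\<Sum>j\<in>triangle m. \<Sum>e\<in>A. scalar (f e) * (scalar (c i j e) * B i j))"
      unfolding sum_distrib_left by (rule sum.swap)
    also have "\<dots> = (\<Sum>j\<in>triangle m. scalar (\<Sum>e\<in>A. c i j e * f e) * B i j)"
    proof (rule sum.cong)
      fix j
      have "scalar (f e) * (scalar (c i j e) * B i j) = scalar (c i j e * f e) * B i j" for e
      proof -
        have "scalar (f e) * scalar (c i j e) = (scalar (c i j e * f e) :: (3, 'a) mpoly)"
          by (simp add: mult_single mult.commute)
        then show ?thesis by (simp only: mult.assoc[symmetric])
      qed
      then show "(\<Sum>e\<in>A. scalar (f e) * (scalar (c i j e) * B i j)) = scalar (\<Sum>e\<in>A. c i j e * f e) * B i j"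
        by (simp only: sum_scalar[symmetric] sum_distrib_right)
    qed simp
    also have "\<dots> = 0" using f(1)[OF i] by (intro sum.neutral) auto
    finally have "(\<Sum>e\<in>A. Poly_Mapping.single (exponent d e) (f e)) =
        (\<Sum>e\<in>A. scalar (f e) * (Poly_Mapping.single (exponent d e) 1 -
          (\<Sum>j\<in>triangle m. scalar (c i j e) * B i j)))"
      by (simp add: right_diff_distrib sum_subtractf mult_single)
    also have "\<dots> \<in> ideal_power (point_ideal (P i)) m"
      using cB[OF i] assms(2) by (intro ideal_power_sum ideal_power_mult) auto
    finally show ?thesis .
  qed
  then show ?thesis using f(2) by (auto simp: fat_points_ideal_def)
qed

lemma fat_points_ideal_sections:
  assumes "homogeneous d f" "f \<in> fat_points_ideal r m P"
  shows "f \<in> sections_vanishing (fat_points_ideal r m P) d"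
  using assms by (auto simp: sections_vanishing_def fat_points_ideal_def intro: ideal_power_mult)

text \<open>Multiplication by a power of the coordinate 0 leads from the saturation into the ideal;
  that power is nonzero at \<open>P i\<close> and can be cancelled.\<close>

lemma sections_vanishing_jets:
  fixes P :: "nat \<Rightarrow> 3 \<Rightarrow> 'a::field"
  assumes "f \<in> sections_vanishing (fat_points_ideal r m P) d" "i < r" "P i 0 \<noteq> 0" "u + v < m"
  shows "(\<Sum>e\<in>triangle (Suc d). jet_coeff ((P i 1 / P i 0, P i 2 / P i 0), u, v) e *
    Poly_Mapping.lookup f (exponent d e)) = 0"
proof (rule vanishing_order_jets[of "P i"])
  obtain n where n: "\<And>g. homogeneous n g \<Longrightarrow> g * f \<in> fat_points_ideal r m P"
    using assms(1) by (auto simp: sections_vanishing_def)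
  define g :: "(3, 'a) mpoly" where "g = Poly_Mapping.single (Poly_Mapping.single 0 n) 1"
  have "homogeneous n g" by (simp add: homogeneous_def g_def sum_3 lookup_single)
  then have "g * f \<in> fat_points_ideal r m P" by (rule n)
  then have "g * f \<in> ideal_power (point_ideal (P i)) m"
    unfolding fat_points_ideal_def using assms(2) by blast
  then have "g * f \<in> vanishing_order_ge (P i) m" using ideal_power_vanishing by blast
  moreover have "mpoly_eval (P i) g \<noteq> 0" using assms(3) by (simp add: g_def)
  ultimately show "f \<in> vanishing_order_ge (P i) m" by (rule vanishing_order_ge_cancel[rotated])
  show "homogeneous d f" using assms(1) by (simp add: sections_vanishing_def)
qed (use assms in auto)

subsection \<open>The Hilbert function\<close>

text \<open>Multiplication by the first affine coordinate shifts exponents by one column. On shifted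
  exponents a condition has weight \<open>(a + 1)^u b^v\<close>, again a polynomial of degree less
  than \<open>m\<close>.\<close>

lemma interpolates_shift:
  fixes X :: "('a::comm_ring_1 \<times> 'a) set"
  assumes "interpolates m X S" "finite S" "(\<lambda>(a, b). (Suc a, b)) ` T \<subseteq> S"
  shows "interpolates m X T"
  unfolding interpolates_def kernel_trivial_def
proof (intro allI impI)
  fix f :: "nat \<times> nat \<Rightarrow> 'a"
  assume f: "\<forall>i\<in>X \<times> {(u, v). u + v < m}. (\<Sum>e\<in>T. jet_coeff i e * f e) = 0"
  define sh :: "nat \<times> nat \<Rightarrow> nat \<times> nat" where "sh = (\<lambda>(a, b). (Suc a, b))"
  have inj: "inj_on sh T" by (auto simp: sh_def inj_on_def)
  define g where "g e = (if e \<in> sh ` T then f (the_inv_into T sh e) else 0)" for e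
  have g_sh: "g (sh e) = f e" if "e \<in> T" for e
    using that by (simp add: g_def the_inv_into_f_f[OF inj])
  have "(\<Sum>e\<in>S. jet_coeff ((x, y), u, v) e * g e) = 0" if xy: "(x, y) \<in> X" "u + v < m" for x y u v
  proof -
    have "(\<Sum>e\<in>S. jet_coeff ((x, y), u, v) e * g e) = (\<Sum>e\<in>sh ` T. jet_coeff ((x, y), u, v) e * g e)"
      using assms(2,3) by (intro sum.mono_neutral_right) (auto simp: g_def sh_def)
    also have "\<dots> = (\<Sum>e\<in>T. jet_coeff ((x, y), u, v) (sh e) * f e)"
      using g_sh by (subst sum.reindex[OF inj]) (auto intro: sum.cong)
    also have "\<dots> = (\<Sum>e\<in>T. x * ((of_nat (fst e) - (- 1)) ^ u * of_nat (snd e) ^ v * (x ^ fst e * y ^ snd e) * f e))"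
      by (intro sum.cong) (auto simp: jet_coeff_def sh_def add.commute ac_simps)
    also have "\<dots> = x * (\<Sum>e\<in>T. (of_nat (fst e) - (- 1)) ^ u * of_nat (snd e) ^ v * (x ^ fst e * y ^ snd e) * f e)"
      by (simp only: sum_distrib_left)
    also have "(\<Sum>e\<in>T. (of_nat (fst e) - (- 1)) ^ u * of_nat (snd e) ^ v * (x ^ fst e * y ^ snd e) * f e) = 0"
    proof (rule jet_coeff_poly_fun)
      show "poly_fun m (\<lambda>e. (of_nat (fst e) - (- 1 :: 'a)) ^ u * of_nat (snd e) ^ v)"
        using xy(2) by (intro poly_fun_mono[OF poly_fun_power]) simp
      show "(\<Sum>e\<in>T. jet_coeff ((x, y), k, l) e * f e) = 0" if "k + l < m" for k l
        using bspec[OF f, of "((x, y), k, l)"] that xy(1) by simp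
    qed
    finally show ?thesis by simp
  qed
  then have "\<forall>e\<in>S. g e = 0"
    using assms(1) unfolding interpolates_def kernel_trivial_def by fast
  then show "\<forall>e\<in>T. f e = 0"
    using g_sh assms(3) unfolding sh_def[symmetric] by (metis image_subset_iff)
qed

lemma hilbert_function_fat_points:
  fixes P :: "nat \<Rightarrow> 3 \<Rightarrow> 'a::field"
  assumes "\<And>i. i < r \<Longrightarrow> P i 0 \<noteq> 0" "p \<le> n"
    and interpolates: "interpolates m ((\<lambda>i. (P i 1 / P i 0, P i 2 / P i 0)) ` {..<r}) (region 0 n p)"
    and card: "card (region 0 n p) = r * card (triangle m)"
  shows "hilbert_function (fat_points_ideal r m P) d =
    min (int (card (triangle (Suc d)))) (int (card (region 0 n p)))"
proof -
  interpret V: vector_space "mpoly_scale :: 'a \<Rightarrow> (3, 'a) mpoly \<Rightarrow> _"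
    by (rule vector_space_mpoly_scale)
  define S where "S = region 0 n p"
  define T where "T = triangle (Suc d)"
  define Q where "Q = sections_vanishing (fat_points_ideal r m P) d"
  have T: "finite T" "card T = (d + 1) * (d + 2) div 2"
    unfolding T_def by (simp_all add: card_triangle[of "Suc d"] del: mult_Suc)
  have finS: "finite S"
    unfolding S_def by (rule finite_bounded_pairs[of _ n]) (auto simp: region_def)
  define J where "J = (\<lambda>i. (P i 1 / P i 0, P i 2 / P i 0)) ` {..<r} \<times> {(u, v). u + v < m}"
  \<comment> \<open>Forms with vanishing jets. Only \<open>Q \<subseteq> W\<close> is shown
    directly.\<close>
  define W where "W = {f. homogeneous d f \<and>
    (\<forall>j\<in>J. (\<Sum>e\<in>T. jet_coeff j e * Poly_Mapping.lookup f (exponent d e)) = 0)}"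
  have QW: "Q \<subseteq> W"
  proof
    fix f assume f: "f \<in> Q"
    have "(\<Sum>e\<in>T. jet_coeff j e * Poly_Mapping.lookup f (exponent d e)) = 0" if j: "j \<in> J" for j
    proof -
      obtain i u v where "i < r" "j = ((P i 1 / P i 0, P i 2 / P i 0), u, v)" "u + v < m"
        using j by (auto simp: J_def)
      then show ?thesis
        using sections_vanishing_jets[OF f[unfolded Q_def]] assms(1) by (simp add: T_def)
    qed
    then show "f \<in> W" using f by (simp add: W_def Q_def sections_vanishing_def)
  qed
  have W: "V.subspace W"
  proof -
    have hom_add: "homogeneous d (f + g)" if "homogeneous d f" "homogeneous d g" for f g :: "(3, 'a) mpoly"
      using that keys_add[of f g] unfolding homogeneous_def by blast
    have hom_scale: "homogeneous d (mpoly_scale c f)" if "homogeneous d f" for f and c :: 'a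
      using that by (simp add: homogeneous_def in_keys_iff lookup_mpoly_scale)
    have scale: "(\<Sum>e\<in>T. jet_coeff j e * (c * Poly_Mapping.lookup f (exponent d e))) =
        c * (\<Sum>e\<in>T. jet_coeff j e * Poly_Mapping.lookup f (exponent d e))" for j c f
      by (simp add: sum_distrib_left mult.left_commute)
    show ?thesis
    proof (rule V.subspaceI)
      show "0 \<in> W" by (simp add: W_def homogeneous_def)
      show "f + g \<in> W" if "f \<in> W" "g \<in> W" for f g
        using that by (simp add: W_def hom_add lookup_add distrib_left sum.distrib)
      show "mpoly_scale c f \<in> W" if "f \<in> W" for c f
        using that by (simp add: W_def hom_scale lookup_mpoly_scale scale)
    qed
  qed
  have zero: "f = 0" if f: "f \<in> W" "\<And>e. e \<in> T \<Longrightarrow> Poly_Mapping.lookup f (exponent d e) = 0" for f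
  proof -
    have "homogeneous d f" using f(1) by (simp add: W_def)
    then have "Poly_Mapping.keys f \<subseteq> exponent d ` T" unfolding T_def by (rule homogeneous_keys)
    then have "Poly_Mapping.lookup f k = 0" for k
      using f(2) by (cases "k \<in> Poly_Mapping.keys f") (auto simp: in_keys_iff)
    then show ?thesis by (intro poly_mapping_eqI) simp
  qed
  have hilbert: "hilbert_function (fat_points_ideal r m P) d = int (card T) - int (V.dim Q)"
    by (simp add: hilbert_function_def T(2) Q_def)
  show ?thesis
  proof (cases "d < n")
    case True
    have TS: "(\<lambda>(a, b). (Suc a, b)) ` T \<subseteq> S"
      using True by (auto simp: T_def S_def region_def)
    have interpolates_T: "interpolates m ((\<lambda>i. (P i 1 / P i 0, P i 2 / P i 0)) ` {..<r}) T"
      by (rule interpolates_shift[OF interpolates]) (use finS TS in \<open>simp_all add: S_def\<close>)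
    have "f = 0" if f: "f \<in> Q" for f
    proof (rule zero)
      show "f \<in> W" using f QW by blast
      then show "Poly_Mapping.lookup f (exponent d e) = 0" if "e \<in> T" for e
        by (intro interpolatesD[OF interpolates_T that, of "\<lambda>e. Poly_Mapping.lookup f (exponent d e)"])
          (unfold J_def[symmetric], simp add: W_def)
    qed
    then have "Q \<subseteq> V.span {}" by auto
    then have "V.dim Q = 0" using V.dim_le_card[of Q "{}"] by simp
    moreover have "card T \<le> card S"
      using card_mono[OF finS TS] by (subst (asm) card_image) (auto simp: inj_on_def)
    ultimately show ?thesis using hilbert by (simp add: S_def T_def)
  next
    case False
    have ST: "S \<subseteq> T" using False by (auto simp: S_def T_def region_def)
    have zero_S: "f = 0"
      if f: "f \<in> W" "\<And>e. e \<in> T - S \<Longrightarrow> Poly_Mapping.lookup f (exponent d e) = 0" for f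
    proof -
      have "(\<Sum>e\<in>S. jet_coeff j e * Poly_Mapping.lookup f (exponent d e)) = 0" if j: "j \<in> J" for j
      proof -
        have "0 = (\<Sum>e\<in>T. jet_coeff j e * Poly_Mapping.lookup f (exponent d e))"
          using f(1) j by (simp add: W_def)
        also have "\<dots> = (\<Sum>e\<in>S. jet_coeff j e * Poly_Mapping.lookup f (exponent d e))"
          using T(1) ST f(2) by (intro sum.mono_neutral_right) auto
        finally show ?thesis by simp
      qed
      then have "Poly_Mapping.lookup f (exponent d e) = 0" if "e \<in> S" for e
        by (intro interpolatesD[OF interpolates[folded S_def] that,
              of "\<lambda>e. Poly_Mapping.lookup f (exponent d e)"])
          (unfold J_def[symmetric], blast)
      then show ?thesis using f by (intro zero) auto
    qed
    \<comment> \<open>Adding one exponent to the square system gives a nonzero form in the ideal.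
      Its coefficient at \<open>e\<close> is nonzero, since a form in \<open>W\<close> supported on
      \<open>S\<close> is zero; normalise it to 1.\<close>
    have "\<exists>G\<in>Q. Poly_Mapping.lookup G (exponent d e) = 1 \<and>
      (\<forall>e'\<in>T - S - {e}. Poly_Mapping.lookup G (exponent d e') = 0)" if e: "e \<in> T - S" for e
    proof -
      have "insert e S \<subseteq> triangle (Suc d)" using ST e by (auto simp: T_def)
      moreover have "r * card (triangle m) < card (insert e S)"
        using e finS card by (simp add: S_def)
      ultimately obtain f where f: "\<exists>e'\<in>insert e S. f e' \<noteq> 0"
        "(\<Sum>e\<in>insert e S. Poly_Mapping.single (exponent d e) (f e)) \<in> fat_points_ideal r m P"
        using exists_fat_points_form[of r P "insert e S" d m] assms(1) by blast
      have scale: "(\<Sum>e\<in>insert e S. Poly_Mapping.single (exponent d e) (c * f e)) \<in> Q" for c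
      proof -
        have "(\<Sum>e\<in>insert e S. Poly_Mapping.single (exponent d e) (c * f e)) =
            scalar c * (\<Sum>e\<in>insert e S. Poly_Mapping.single (exponent d e) (f e))"
          by (simp only: sum_distrib_left mult_single add_0)
        then have "(\<Sum>e\<in>insert e S. Poly_Mapping.single (exponent d e) (c * f e)) \<in> fat_points_ideal r m P"
          using f(2) by (auto simp: fat_points_ideal_def intro: ideal_power_mult)
        then show ?thesis
          unfolding Q_def using \<open>insert e S \<subseteq> triangle (Suc d)\<close>
          by (intro fat_points_ideal_sections homogeneous_sum_exponent)
      qed
      have lookup: "Poly_Mapping.lookup (\<Sum>e\<in>insert e S. Poly_Mapping.single (exponent d e) (c * f e)) (exponent d e') =
          (if e' \<in> insert e S then c * f e' else 0)" for c e'
        by (rule lookup_sum_exponent) (simp add: finS)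
      have "f e \<noteq> 0"
      proof
        assume "f e = 0"
        then have "(\<Sum>e\<in>insert e S. Poly_Mapping.single (exponent d e) (1 * f e)) = 0"
          by (intro zero_S[OF subsetD[OF QW scale]]) (simp only: lookup, auto)
        then have "Poly_Mapping.lookup (\<Sum>e\<in>insert e S. Poly_Mapping.single (exponent d e) (1 * f e)) (exponent d e') = 0" for e'
          by simp
        then have "\<forall>e'\<in>insert e S. f e' = 0" unfolding lookup by (metis mult_1)
        then show False using f(1) by blast
      qed
      then show ?thesis
        using e by (intro bexI[OF _ scale[of "inverse (f e)"]]) (simp only: lookup, auto)
    qed
    then obtain G where G: "\<And>e. e \<in> T - S \<Longrightarrow> G e \<in> Q"
      "\<And>e e'. e \<in> T - S \<Longrightarrow> e' \<in> T - S \<Longrightarrow>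
        Poly_Mapping.lookup (G e) (exponent d e') = (if e' = e then 1 else 0)"
      by (metis DiffI singletonD)
    have lookup_comb: "Poly_Mapping.lookup (\<Sum>e\<in>T - S. mpoly_scale (h e) (G e)) (exponent d e') = h e'"
      if "e' \<in> T - S" for h e'
    proof -
      have "Poly_Mapping.lookup (\<Sum>e\<in>T - S. mpoly_scale (h e) (G e)) (exponent d e') =
          (\<Sum>e\<in>T - S. if e = e' then h e else 0)"
        unfolding lookup_sum lookup_mpoly_scale using G(2)[OF _ that] by (intro sum.cong) auto
      then show ?thesis using that T(1) by simp
    qed
    have inj: "inj_on G (T - S)"
      by (rule inj_onI) (metis G(2) zero_neq_one)
    have "V.dim Q = card (G ` (T - S))"
    proof (rule V.dim_unique[OF _ _ _ refl])
      show "G ` (T - S) \<subseteq> Q" using G(1) by blast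
      show "V.independent (G ` (T - S))"
        unfolding V.dependent_finite[OF finite_imageI[OF finite_Diff[OF T(1)]]]
      proof
        assume "\<exists>u. (\<exists>v\<in>G ` (T - S). u v \<noteq> 0) \<and> (\<Sum>v\<in>G ` (T - S). mpoly_scale (u v) v) = 0"
        then obtain u e where u: "e \<in> T - S" "u (G e) \<noteq> 0" "(\<Sum>v\<in>G ` (T - S). mpoly_scale (u v) v) = 0"
          by blast
        then have "(\<Sum>e\<in>T - S. mpoly_scale (u (G e)) (G e)) = 0"
          by (simp add: sum.reindex[OF inj])
        then show False using lookup_comb[OF u(1), of "\<lambda>e. u (G e)"] u(2) by simp
      qed
      show "Q \<subseteq> V.span (G ` (T - S))"
      proof
        fix f assume f: "f \<in> Q"
        define h where "h = f - (\<Sum>e\<in>T - S. mpoly_scale (Poly_Mapping.lookup f (exponent d e)) (G e))"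
        \<comment> \<open>Subtracting the \<open>G e\<close> removes all coefficients outside
          \<open>S\<close>, so the difference is zero and the \<open>G e\<close> span
          \<open>Q\<close>.\<close>
        have "h \<in> W"
          unfolding h_def using f G(1) QW by (intro V.subspace_diff V.subspace_sum V.subspace_scale W) auto
        then have "h = 0"
          by (rule zero_S) (simp add: h_def lookup_minus lookup_comb)
        then have "f = (\<Sum>e\<in>T - S. mpoly_scale (Poly_Mapping.lookup f (exponent d e)) (G e))"
          by (simp add: h_def)
        also have "\<dots> \<in> V.span (G ` (T - S))"
          by (intro V.span_sum V.span_scale V.span_base) blast
        finally show "f \<in> V.span (G ` (T - S))" .
      qed
    qed
    then have "V.dim Q = card T - card S"
      using card_image[OF inj] card_Diff_subset[OF finS ST] by simp
    then show ?thesis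
      using hilbert card_mono[OF T(1) ST] by (simp add: S_def T_def of_nat_diff)
  qed
qed

theorem theorem11:
  fixes F :: "'a::field_char_0 set"
    and P :: "nat \<Rightarrow> 3 \<Rightarrow> 'a"
    and k m :: nat
  assumes "is_subfield F"
    and "k \<ge> 1" and "m \<ge> 1"
    and "generic_points F (k\<^sup>2) P"
  shows "\<forall>d::nat. hilbert_function (fat_points_ideal (k\<^sup>2) m P) d =
           min (int ((d + 1) * (d + 2) div 2)) (int (k\<^sup>2 * (m * (m + 1) div 2)))"
proof
  fix d
  define M where "M = m * (m + 1) div 2"
  have M: "m * (m + 1) = 2 * M" by (simp add: M_def)
  obtain n p where np: "p \<le> n" "n * (n + 1) + 2 * p = 2 * (k\<^sup>2 * M)"
    using triangular_decomposition by blast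
  have "nondegenerate TYPE('a) m (k\<^sup>2) (region 0 n p)"
  proof (rule nondegenerate_region[OF assms(2,3) np(1)])
    show "n * (n + 1) + 2 * p = k\<^sup>2 * (m * (m + 1))"
      by (simp only: M np(2) mult.left_commute)
  qed
  then have "interpolates m ((\<lambda>i. (P i 1 / P i 0, P i 2 / P i 0)) ` {..<k\<^sup>2}) (region 0 n p)"
    by (rule generic_interpolates[OF assms(1,4)])
  moreover have card: "card (region 0 n p) = k\<^sup>2 * M"
    using np by (simp add: card_region)
  moreover have "P i 0 \<noteq> 0" if "i < k\<^sup>2" for i
    using assms(4) that by (simp add: generic_points_def)
  ultimately have "hilbert_function (fat_points_ideal (k\<^sup>2) m P) d =
      min (int (card (triangle (Suc d)))) (int (card (region 0 n p)))"
    using np(1) by (intro hilbert_function_fat_points) (simp_all add: card_triangle[of m] M_def)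
  then show "hilbert_function (fat_points_ideal (k\<^sup>2) m P) d =
      min (int ((d + 1) * (d + 2) div 2)) (int (k\<^sup>2 * (m * (m + 1) div 2)))"
    unfolding card card_triangle M_def by simp
qed

end
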